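(* Let $F=(V;E,A)$ be a mixed graph, let $k$ be a positive integer, and let $f,g: V\to\mathbb{N}$ be functions with $f\le g$ (pointwise). Then there exist $k$ pairwise edge- and arc-disjoint spanning mixed arborescences $F_1,\ldots,F_k$ in $F$ such that $F_i$ is rooted at some $r_i\in V$ for $1\le i\le k$ and $$f(v)\le |\{i\in\{1,\ldots,k\}: r_i=v\}|\le g(v)\quad\text{for every } v\in V,$$ if and only if all of the following hold: (i) $\widetilde{f}(V)\le k$; (ii) for every subpartition $\mathcal{P}=\{X_1,\ldots,X_t\}$ of $V$, $$e_E(\mathcal{P})+\sum_{j=1}^t d_A^-(X_j)\ \ge\ k(t-1)+\widetilde{f}\Big(V\setminus \bigcup_{j=1}^t X_j\Big);$$ (iii) for every subpartition $\mathcal{P}=\{X_1,\ldots,X_t\}$ of $V$, $$e_E(\mathcal{P})+\sum_{j=1}^t d_A^-(X_j)\ \ge\ kt-\widetilde{g}\Big(\bigcup_{j=1}^t X_j\Big).$$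
   Context: A mixed graph $F=(V;E,A)$ has vertex set $V$, a set $E$ of undirected edges and a set $A$ of directed arcs; multiple edges/arcs are allowed, loops are not. A subgraph $T$ of $F$ (not necessarily spanning) is an $r$-mixed arborescence if its underlying graph is a tree and its undirected edges can be oriented so that the result is an $r$-arborescence (a directed tree in which every vertex is reachable from $r$ by a unique directed path); $r$ is its root. It is spanning if its vertex set is $V$. A subpartition of $V$ is a family $\mathcal{P}=\{X_1,\ldots,X_t\}$ of pairwise disjoint subsets of $V$ (not necessarily covering $V$). For such $\mathcal{P}$, $e_E(\mathcal{P})$ denotes the number of edges $e\in E$ such that one end of $e$ lies in some $X_i$ and the other end lies either in some $X_j$ with $j\ne i$ or in $V\setminus\bigcup_{j=1}^t X_j$. For $X\subseteq V$, $d_A^-(X)$ is the number of arcs in $A$ with tail outside $X$ and head in $X$. For $h:V\to\mathbb{N}$ and $X\subseteq V$, $\widetilde{h}(X)=\sum_{x\in X}h(x)$. *)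

theory Defs
  imports "Graph_Theory.Arc_Walk" "HOL-Library.Disjoint_Sets"
begin

text \<open>
  A mixed graph extends a multi-digraph by a set of undirected edges. Edges and arcs
  are abstract identifiers, so parallel edges and parallel arcs are allowed.
\<close>

record ('v, 'a, 'e) mixed_graph = "('v, 'a) pre_digraph" +
  edges :: "'e set"
  ends :: "'e \<Rightarrow> 'v set"

locale mixed_graph =
  fixes F :: "('v, 'a, 'e) mixed_graph"
  assumes finite_verts: "finite (verts F)"
    and verts_nonempty: "verts F \<noteq> {}"
    and finite_edges: "finite (edges F)"
    and finite_arcs: "finite (arcs F)"
    and edge_ends: "e \<in> edges F \<Longrightarrow> ends F e \<subseteq> verts F \<and> card (ends F e) = 2"
    and arc_tail: "a \<in> arcs F \<Longrightarrow> tail F a \<in> verts F"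
    and arc_head: "a \<in> arcs F \<Longrightarrow> head F a \<in> verts F"
    and arc_no_loop: "a \<in> arcs F \<Longrightarrow> tail F a \<noteq> head F a"

definition mixed_subgraph :: "('v, 'a, 'e) mixed_graph \<Rightarrow> ('v, 'a, 'e) mixed_graph \<Rightarrow> bool" where
  "mixed_subgraph T F \<longleftrightarrow> mixed_graph T \<and>
     verts T \<subseteq> verts F \<and> edges T \<subseteq> edges F \<and> arcs T \<subseteq> arcs F \<and>
     ends T = ends F \<and> tail T = tail F \<and> head T = head F"

text \<open>
  Undirected multigraphs are given by a vertex set \<open>V\<close>, a set \<open>X\<close> of edge identifiers and
  the map \<open>en\<close> from an edge to its set of ends. (In the Graph-Theory entry, \<open>forest\<close> and
  \<open>tree\<close> only exclude directed cycles, so they do not express that the underlying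
  undirected graph is a tree.) A cycle of length two consists of two parallel edges.
\<close>

definition undirected_connected :: "'v set \<Rightarrow> 'x set \<Rightarrow> ('x \<Rightarrow> 'v set) \<Rightarrow> bool" where
  "undirected_connected V X en \<longleftrightarrow> V \<noteq> {} \<and>
     (\<forall>u\<in>V. \<forall>v\<in>V. (u, v) \<in> {(x, y). \<exists>e\<in>X. en e = {x, y}}\<^sup>*)"

definition undirected_cycle :: "'x set \<Rightarrow> ('x \<Rightarrow> 'v set) \<Rightarrow> 'v list \<Rightarrow> 'x list \<Rightarrow> bool" where
  "undirected_cycle X en vs es \<longleftrightarrow>
     es \<noteq> [] \<and> length vs = length es \<and> distinct vs \<and> distinct es \<and> set es \<subseteq> X \<and>
     (\<forall>i<length es. en (es ! i) = {vs ! i, vs ! (Suc i mod length es)})"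

definition undirected_tree :: "'v set \<Rightarrow> 'x set \<Rightarrow> ('x \<Rightarrow> 'v set) \<Rightarrow> bool" where
  "undirected_tree V X en \<longleftrightarrow>
     undirected_connected V X en \<and> \<not> (\<exists>vs es. undirected_cycle X en vs es)"

text \<open>The edges of the underlying graph of a mixed graph are \<open>edges T <+> arcs T\<close>.\<close>

definition underlying_ends :: "('v, 'a, 'e) mixed_graph \<Rightarrow> 'e + 'a \<Rightarrow> 'v set" where
  "underlying_ends T x = (case x of Inl e \<Rightarrow> ends T e | Inr a \<Rightarrow> {tail T a, head T a})"

definition arborescence :: "('v, 'x) pre_digraph \<Rightarrow> 'v \<Rightarrow> bool" where
  "arborescence D r \<longleftrightarrow> wf_digraph D \<and> r \<in> verts D \<and>
     undirected_tree (verts D) (arcs D) (\<lambda>x. {tail D x, head D x}) \<and>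
     (\<forall>v\<in>verts D. \<exists>!p. pre_digraph.apath D r p v)"

definition is_orientation :: "('v, 'a, 'e) mixed_graph \<Rightarrow> ('v, 'e + 'a) pre_digraph \<Rightarrow> bool" where
  "is_orientation T D \<longleftrightarrow>
     verts D = verts T \<and> arcs D = edges T <+> arcs T \<and>
     (\<forall>e\<in>edges T. {tail D (Inl e), head D (Inl e)} = ends T e) \<and>
     (\<forall>a\<in>arcs T. tail D (Inr a) = tail T a \<and> head D (Inr a) = head T a)"

definition mixed_arborescence :: "('v, 'a, 'e) mixed_graph \<Rightarrow> 'v \<Rightarrow> ('v, 'a, 'e) mixed_graph \<Rightarrow> bool" where
  "mixed_arborescence F r T \<longleftrightarrow> mixed_subgraph T F \<and>
     undirected_tree (verts T) (edges T <+> arcs T) (underlying_ends T) \<and>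
     (\<exists>D. is_orientation T D \<and> arborescence D r)"

definition spanning_mixed_arborescence :: "('v, 'a, 'e) mixed_graph \<Rightarrow> 'v \<Rightarrow> ('v, 'a, 'e) mixed_graph \<Rightarrow> bool" where
  "spanning_mixed_arborescence F r T \<longleftrightarrow> mixed_arborescence F r T \<and> verts T = verts F"

text \<open>
  As usual, the members of a subpartition are nonempty. The empty subpartition is allowed.
\<close>

definition subpartition :: "'v set \<Rightarrow> 'v set set \<Rightarrow> bool" where
  "subpartition V P \<longleftrightarrow> \<Union>P \<subseteq> V \<and> disjoint P \<and> {} \<notin> P"

definition crossing_edges :: "('v, 'a, 'e) mixed_graph \<Rightarrow> 'v set set \<Rightarrow> nat" where
  "crossing_edges F P = card {e \<in> edges F. \<exists>u v. ends F e = {u, v} \<and>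
     (\<exists>X\<in>P. u \<in> X \<and> ((\<exists>Y\<in>P. Y \<noteq> X \<and> v \<in> Y) \<or> v \<in> verts F - \<Union>P))}"

definition in_deg :: "('v, 'a, 'e) mixed_graph \<Rightarrow> 'v set \<Rightarrow> nat" where
  "in_deg F X = card {a \<in> arcs F. tail F a \<notin> X \<and> head F a \<in> X}"

end

theory Submission
  imports Defs
begin

text \<open>
  Each of (ii) and (iii) says that a set function \<open>b\<close>, supermodular on intersecting pairs, sums
  over a subpartition \<open>P\<close> to at most a submodular function of \<open>\<Union>P\<close>: here \<open>b X\<close> is \<open>k\<close>
  minus the in-degree of \<open>X\<close> plus the number of edges inside \<open>X\<close>, and the bound counts the edges
  meeting \<open>\<Union>P\<close>. If neither orientation of an edge \<open>uv\<close> preserves these conditions, there are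
  tight subpartitions \<open>P\<close> and \<open>Q\<close> with \<open>u \<in> \<Union>P - \<Union>Q\<close> and \<open>v \<in> \<Union>Q - \<Union>P\<close>;
  uncrossing them gives subpartitions of \<open>\<Union>P \<union> \<Union>Q\<close> and of \<open>\<Union>P \<inter> \<Union>Q\<close> one of which
  violates a condition, since \<open>uv\<close> is counted at most once after uncrossing but twice before.
  So all edges can be oriented. By the same argument, while \<open>f v < g v\<close> one can raise \<open>f v\<close> or
  lower \<open>g v\<close>, until \<open>f = g\<close> prescribes the roots. What is left is Edmonds' theorem on disjoint
  arborescences, proved as by Lovasz: grow the arborescences arc by arc, choosing the next arc
  inside a minimal tight set.
\<close>

section \<open>Uncrossing subpartitions\<close>

text \<open>The in-degree as an integer sum of indicators, so that submodularity can be checked one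
  arc at a time; \<open>induced\<close> and \<open>touching\<close> have the same form for
  edges.\<close>

definition entering :: "'x set \<Rightarrow> ('x \<Rightarrow> 'v) \<Rightarrow> ('x \<Rightarrow> 'v) \<Rightarrow> 'v set \<Rightarrow> int" where
  "entering A t h X = (\<Sum>a\<in>A. of_bool (t a \<notin> X \<and> h a \<in> X))"

definition induced :: "'x set \<Rightarrow> ('x \<Rightarrow> 'v set) \<Rightarrow> 'v set \<Rightarrow> int" where
  "induced E en X = (\<Sum>e\<in>E. of_bool (en e \<subseteq> X))"

definition touching :: "'x set \<Rightarrow> ('x \<Rightarrow> 'v set) \<Rightarrow> 'v set \<Rightarrow> int" where
  "touching E en S = (\<Sum>e\<in>E. of_bool (en e \<inter> S \<noteq> {}))"

definition demand ::
    "nat \<Rightarrow> 'x set \<Rightarrow> ('x \<Rightarrow> 'v set) \<Rightarrow> 'x set \<Rightarrow> ('x \<Rightarrow> 'v) \<Rightarrow> ('x \<Rightarrow> 'v) \<Rightarrow> 'v set \<Rightarrow> int" where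
  "demand k E en A t h X = int k - entering A t h X + induced E en X"

text \<open>Only pairs that meet are constrained, because uncrossing replaces only such pairs; the
  empty set then never becomes a member.\<close>

definition intersecting_supermodular :: "('v set \<Rightarrow> int) \<Rightarrow> bool" where
  "intersecting_supermodular b \<longleftrightarrow>
     (\<forall>X Y. X \<inter> Y \<noteq> {} \<longrightarrow> b X + b Y \<le> b (X \<inter> Y) + b (X \<union> Y))"

lemma entering_submodular:
  "entering A t h (X \<inter> Y) + entering A t h (X \<union> Y) \<le> entering A t h X + entering A t h Y"
  unfolding entering_def sum.distrib[symmetric] by (rule sum_mono) auto

lemma demand_intersecting_supermodular: "intersecting_supermodular (demand k E en A t h)"
proof -
  have "induced E en X + induced E en Y \<le> induced E en (X \<inter> Y) + induced E en (X \<union> Y)" for X Y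
    unfolding induced_def sum.distrib[symmetric] by (rule sum_mono) auto
  then show ?thesis
    using entering_submodular[of A t h]
    unfolding intersecting_supermodular_def demand_def by (smt (verit))
qed

lemma touching_submodular:
  "touching E en (X \<union> Y) + touching E en (X \<inter> Y) \<le> touching E en X + touching E en Y"
  unfolding touching_def sum.distrib[symmetric] by (rule sum_mono) auto

text \<open>The edge \<open>e\<close> meets both \<open>X\<close> and \<open>Y\<close>, so it counts
  twice on the right. On the left it counts once: it meets the union but not the
  intersection.\<close>

lemma touching_submodular_strict:
  assumes "finite E" "e \<in> E" "en e = {u, v}" "u \<in> X - Y" "v \<in> Y - X"
  shows "touching E en (X \<union> Y) + touching E en (X \<inter> Y) < touching E en X + touching E en Y"
  unfolding touching_def sum.distrib[symmetric]
proof (rule sum_strict_mono_ex1)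
  show "\<exists>e\<in>E. (of_bool (en e \<inter> (X \<union> Y) \<noteq> {}) + of_bool (en e \<inter> (X \<inter> Y) \<noteq> {}) :: int)
      < of_bool (en e \<inter> X \<noteq> {}) + of_bool (en e \<inter> Y \<noteq> {})"
    using assms by (intro bexI[of _ e]) auto
qed (use assms in auto)

text \<open>\<open>Y\<close> absorbs the members of \<open>P\<close> that it meets, one at a time.
  Each such step trades \<open>X\<close> and \<open>Y\<close> for \<open>X \<inter> Y\<close>, which
  is put into \<open>Q'\<close>, and \<open>X \<union> Y\<close>, which takes the place of
  \<open>Y\<close> for the remaining members; the final union joins \<open>P'\<close>.\<close>

lemma uncross_set:
  assumes "finite P" "disjoint P" "{} \<notin> P" "Y \<noteq> {}" "intersecting_supermodular b"
  shows "\<exists>P' Q'. finite P' \<and> disjoint P' \<and> {} \<notin> P' \<and> finite Q' \<and> disjoint Q' \<and> {} \<notin> Q' \<and>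
    \<Union>P' = \<Union>P \<union> Y \<and> \<Union>Q' = \<Union>P \<inter> Y \<and> sum b P + b Y \<le> sum b P' + sum b Q'"
  using assms
proof (induction P arbitrary: Y rule: finite_induct)
  case empty
  show ?case
    by (rule exI[of _ "{Y}"], rule exI[of _ "{}"]) (use empty in \<open>auto simp: disjoint_def\<close>)
next
  case (insert X P)
  have dj: "disjoint P" "{} \<notin> P" "X \<noteq> {}" and XP: "X \<inter> \<Union>P = {}"
    using insert.prems insert.hyps by (auto simp: disjoint_def)
  show ?case
  proof (cases "X \<inter> Y = {}")
    case True
    from insert.IH[OF dj(1,2) insert.prems(3,4)] obtain P' Q' where
      P': "finite P'" "disjoint P'" "{} \<notin> P'" "finite Q'" "disjoint Q'" "{} \<notin> Q'"
      "\<Union>P' = \<Union>P \<union> Y" "\<Union>Q' = \<Union>P \<inter> Y" "sum b P + b Y \<le> sum b P' + sum b Q'"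
      by (elim exE conjE) (rule that)
    have XP': "X \<inter> \<Union>P' = {}" using True XP P'(7) by auto
    then have "X \<notin> P'" using dj by auto
    show ?thesis
    proof (intro exI conjI)
      show "disjoint (insert X P')" using P'(2) XP' by (auto simp: disjoint_def)
      show "\<Union>(insert X P') = \<Union>(insert X P) \<union> Y" using P'(7) by auto
      show "\<Union>Q' = \<Union>(insert X P) \<inter> Y" using P'(8) True by auto
      show "sum b (insert X P) + b Y \<le> sum b (insert X P') + sum b Q'"
        using P'(1,9) \<open>X \<notin> P'\<close> insert.hyps by simp
    qed (use P'(1,3-6) dj(3) in simp_all)
  next
    case False
    have "X \<union> Y \<noteq> {}" using dj(3) by simp
    from insert.IH[OF dj(1,2) this insert.prems(4)] obtain P' Q' where
      P': "finite P'" "disjoint P'" "{} \<notin> P'" "finite Q'" "disjoint Q'" "{} \<notin> Q'"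
      "\<Union>P' = \<Union>P \<union> (X \<union> Y)" "\<Union>Q' = \<Union>P \<inter> (X \<union> Y)"
      "sum b P + b (X \<union> Y) \<le> sum b P' + sum b Q'"
      by (elim exE conjE) (rule that)
    \<comment> \<open>\<open>\<Union>Q'\<close> lies in \<open>\<Union>P\<close>, which
      \<open>X\<close> avoids, so \<open>X \<inter> Y\<close> can join \<open>Q'\<close>.\<close>
    have XQ: "X \<inter> Y \<inter> \<Union>Q' = {}" using XP P'(8) by auto
    then have n: "X \<inter> Y \<notin> Q'" using False by auto
    have "b X + b Y \<le> b (X \<inter> Y) + b (X \<union> Y)"
      using False insert.prems(4) unfolding intersecting_supermodular_def by blast
    then have s: "sum b (insert X P) + b Y \<le> sum b P' + sum b (insert (X \<inter> Y) Q')"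
      using P'(4,9) n insert.hyps by simp
    have d: "disjoint (insert (X \<inter> Y) Q')" using P'(5) XQ by (auto simp: disjoint_def)
    show ?thesis
    proof (intro exI conjI)
      show "\<Union>P' = \<Union>(insert X P) \<union> Y" using P'(7) by auto
      show "\<Union>(insert (X \<inter> Y) Q') = \<Union>(insert X P) \<inter> Y" using P'(8) XP by auto
    qed (use P'(1-4,6) s d False in auto)
  qed
qed

text \<open>The members of \<open>Q\<close> are fed to \<open>uncross_set\<close> one after another.
  The intersection parts produced for different members lie inside those members, hence are disjoint
  and can be collected in one family.\<close>

lemma uncross_families:
  assumes "finite Q" "disjoint Q" "{} \<notin> Q" "finite P" "disjoint P" "{} \<notin> P"
    "intersecting_supermodular b"
  shows "\<exists>P' Q'. disjoint P' \<and> {} \<notin> P' \<and> finite Q' \<and> disjoint Q' \<and> {} \<notin> Q' \<and>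
    \<Union>P' = \<Union>P \<union> \<Union>Q \<and> \<Union>Q' = \<Union>P \<inter> \<Union>Q \<and> sum b P + sum b Q \<le> sum b P' + sum b Q'"
  using assms
proof (induction Q arbitrary: P rule: finite_induct)
  case empty
  show ?case
    by (rule exI[of _ P], rule exI[of _ "{}"]) (use empty in \<open>auto simp: disjoint_def\<close>)
next
  case (insert Y Q)
  have dj: "disjoint Q" "{} \<notin> Q" "Y \<noteq> {}" and YQ: "Y \<inter> \<Union>Q = {}"
    using insert.prems insert.hyps by (auto simp: disjoint_def)
  from uncross_set[OF insert.prems(3-5) dj(3) insert.prems(6)] obtain P1 Q1 where
    P1: "finite P1" "disjoint P1" "{} \<notin> P1" "finite Q1" "disjoint Q1" "{} \<notin> Q1"
      "\<Union>P1 = \<Union>P \<union> Y" "\<Union>Q1 = \<Union>P \<inter> Y" "sum b P + b Y \<le> sum b P1 + sum b Q1"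
    by (elim exE conjE) (rule that)
  from insert.IH[OF dj(1,2) P1(1-3) insert.prems(6)] obtain P' Q' where
    P': "disjoint P'" "{} \<notin> P'" "finite Q'" "disjoint Q'" "{} \<notin> Q'"
      "\<Union>P' = \<Union>P1 \<union> \<Union>Q" "\<Union>Q' = \<Union>P1 \<inter> \<Union>Q" "sum b P1 + sum b Q \<le> sum b P' + sum b Q'"
    by (elim exE conjE) (rule that)
  have QQ: "\<Union>Q1 \<inter> \<Union>Q' = {}" using YQ P1(8) P'(7) by auto
  \<comment> \<open>Families with disjoint unions share no member, since no member is empty.\<close>
  have "Q1 \<inter> Q' = {}"
  proof (rule equals0I)
    fix Z assume Z: "Z \<in> Q1 \<inter> Q'"
    then have "Z \<subseteq> \<Union>Q1 \<inter> \<Union>Q'" by auto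
    with QQ P1(6) Z show False by auto
  qed
  then have s: "sum b (Q1 \<union> Q') = sum b Q1 + sum b Q'" using P1(4) P'(3) by (simp add: sum.union_disjoint)
  have d: "disjoint (Q1 \<union> Q')" using P1(5) P'(4) QQ by (rule disjoint_union)
  have u: "\<Union>(Q1 \<union> Q') = \<Union>P \<inter> \<Union>(insert Y Q)" using P1(7,8) P'(7) YQ by auto
  show ?case
  proof (intro exI conjI)
    show "\<Union>P' = \<Union>P \<union> \<Union>(insert Y Q)" using P'(6) P1(7) by auto
    show "sum b P + sum b (insert Y Q) \<le> sum b P' + sum b (Q1 \<union> Q')"
      using P1(9) P'(8) s insert.hyps by simp
  qed (use P1(4,6) P'(1-3,5) d u in auto)
qed

text \<open>\<open>ca\<close> and \<open>cb\<close> are the bounds that \<open>P\<close> and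
  \<open>Q\<close> reach, \<open>cc\<close> and \<open>cd\<close> the bounds used for the union and
  the intersection. Separate names permit mixing the lower with the upper capacity.\<close>

lemma tight_subpartitions_contradiction:
  assumes "finite V" and b: "intersecting_supermodular b"
    and P: "subpartition V P" "ca (\<Union>P) \<le> sum b P"
    and Q: "subpartition V Q" "cb (\<Union>Q) \<le> sum b Q"
    and cc: "\<forall>R. subpartition V R \<longrightarrow> sum b R \<le> cc (\<Union>R)"
    and cd: "\<forall>R. subpartition V R \<longrightarrow> sum b R \<le> cd (\<Union>R)"
    and less: "cc (\<Union>P \<union> \<Union>Q) + cd (\<Union>P \<inter> \<Union>Q) < ca (\<Union>P) + (cb (\<Union>Q) :: int)"
  shows False
proof -
  have fin: "finite R" if "subpartition V R" for R
    using that \<open>finite V\<close> unfolding subpartition_def by (meson finite_UnionD finite_subset)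
  obtain P' Q' where
    "disjoint P'" "{} \<notin> P'" "disjoint Q'" "{} \<notin> Q'" and u: "\<Union>P' = \<Union>P \<union> \<Union>Q" "\<Union>Q' = \<Union>P \<inter> \<Union>Q"
    and s: "sum b P + sum b Q \<le> sum b P' + sum b Q'"
    using uncross_families[of Q P b] b P(1) Q(1) fin unfolding subpartition_def by metis
  then have "subpartition V P'" "subpartition V Q'"
    using P(1) Q(1) unfolding subpartition_def by auto
  with cc cd u have "sum b P' \<le> cc (\<Union>P \<union> \<Union>Q)" "sum b Q' \<le> cd (\<Union>P \<inter> \<Union>Q)" by metis+
  with s P(2) Q(2) less show False by linarith
qed

section \<open>Capacities, and the effect of orienting one edge\<close>

definition lower_capacity ::
    "'v set \<Rightarrow> nat \<Rightarrow> ('v \<Rightarrow> nat) \<Rightarrow> 'x set \<Rightarrow> ('x \<Rightarrow> 'v set) \<Rightarrow> 'v set \<Rightarrow> int" where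
  "lower_capacity V k f E en S = touching E en S + int k - int (\<Sum>v\<in>V - S. f v)"

definition upper_capacity ::
    "('v \<Rightarrow> nat) \<Rightarrow> 'x set \<Rightarrow> ('x \<Rightarrow> 'v set) \<Rightarrow> 'v set \<Rightarrow> int" where
  "upper_capacity g E en S = touching E en S + int (\<Sum>v\<in>S. g v)"

text \<open>Conditions (ii) and (iii), solved for the sum of demands: an edge crosses the
  subpartition if it meets \<open>\<Union>P\<close> without lying inside a member, and the edges
  inside members are moved into \<open>demand\<close>. For \<open>P = {}\<close> the first
  inequality reads \<open>sum f V \<le> k\<close>, which is (i).\<close>

definition packing_condition ::
    "'v set \<Rightarrow> nat \<Rightarrow> ('v \<Rightarrow> nat) \<Rightarrow> ('v \<Rightarrow> nat) \<Rightarrow>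
      'x set \<Rightarrow> ('x \<Rightarrow> 'v set) \<Rightarrow> 'x set \<Rightarrow> ('x \<Rightarrow> 'v) \<Rightarrow> ('x \<Rightarrow> 'v) \<Rightarrow> bool" where
  "packing_condition V k f g E en A t h \<longleftrightarrow> (\<forall>P. subpartition V P \<longrightarrow>
     sum (demand k E en A t h) P \<le> lower_capacity V k f E en (\<Union>P) \<and>
     sum (demand k E en A t h) P \<le> upper_capacity g E en (\<Union>P))"

text \<open>The last two identities isolate \<open>T - S\<close>, the set on which \<open>f\<close>
  is compared with \<open>g\<close> once a lower and an upper capacity are mixed.\<close>

lemma sum_Diff_Un_Int:
  fixes f :: "'v \<Rightarrow> nat"
  assumes "finite V" "S \<subseteq> V" "T \<subseteq> V"
  shows "sum f (V - (S \<union> T)) + sum f (V - S \<inter> T) = sum f (V - S) + sum f (V - T)"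
    "sum f (S \<union> T) + sum f (S \<inter> T) = sum f S + sum f T"
    "sum f (V - S) = sum f (V - (S \<union> T)) + sum f (T - S)"
    "sum f T = sum f (S \<inter> T) + sum f (T - S)"
proof -
  have fin: "finite S" "finite T" using assms finite_subset by auto
  show "sum f (V - (S \<union> T)) + sum f (V - S \<inter> T) = sum f (V - S) + sum f (V - T)"
    using sum.union_inter[of "V - S" "V - T" f] assms
    by (simp add: Diff_Int Diff_Un add.commute)
  show "sum f (S \<union> T) + sum f (S \<inter> T) = sum f S + sum f T"
    using sum.union_inter[of S T f] fin by simp
  have "V - S = (V - (S \<union> T)) \<union> (T - S)" "(V - (S \<union> T)) \<inter> (T - S) = {}"
    using assms by auto
  then show "sum f (V - S) = sum f (V - (S \<union> T)) + sum f (T - S)"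
    using assms(1) fin by (metis finite_Diff sum.union_disjoint)
  have "T = (S \<inter> T) \<union> (T - S)" "(S \<inter> T) \<inter> (T - S) = {}" by auto
  then show "sum f T = sum f (S \<inter> T) + sum f (T - S)"
    using fin by (metis finite_Diff finite_Int sum.union_disjoint)
qed

lemma sum_of_bool_mem:
  assumes "disjoint P" "finite P"
  shows "(\<Sum>X\<in>P. of_bool (v \<in> X)) = (of_bool (v \<in> \<Union>P) :: int)"
proof (cases "v \<in> \<Union>P")
  case True
  then obtain X where X: "X \<in> P" "v \<in> X" by auto
  then have "v \<notin> Y" if "Y \<in> P - {X}" for Y using assms that unfolding disjoint_def by blast
  then have "(\<Sum>X\<in>P. of_bool (v \<in> X)) = (of_bool (v \<in> X) :: int)"
    using X assms by (subst sum.remove[of _ X]) auto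
  with True X show ?thesis by simp
qed auto

text \<open>Making \<open>e\<close> an arc from \<open>u\<close> to \<open>v\<close> lowers the
  demand sum by one if \<open>v \<in> \<Union>P\<close>, and both capacities by one if
  \<open>u\<close> or \<open>v\<close> is in \<open>\<Union>P\<close>. The slack thus shrinks only
  if \<open>u\<close> is inside and \<open>v\<close> outside, and then by one, so a bound that
  becomes violated was tight before.\<close>

lemma packing_condition_orient:
  assumes "finite V" "finite E" "finite A" "e \<notin> E" "e \<notin> A"
    and en: "en e = {u, v}" "u \<noteq> v"
    and old: "packing_condition V k f g (insert e E) en A t h"
    and fail: "\<not> packing_condition V k f g E en (insert e A) (t(e := u)) (h(e := v))"
  shows "\<exists>P. subpartition V P \<and> u \<in> \<Union>P \<and> v \<notin> \<Union>P \<and>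
     (lower_capacity V k f (insert e E) en (\<Union>P)
        \<le> sum (demand k (insert e E) en A t h) P \<or>
      upper_capacity g (insert e E) en (\<Union>P)
        \<le> sum (demand k (insert e E) en A t h) P)"
proof -
  have ent: "entering (insert e A) (t(e := u)) (h(e := v)) X
      = of_bool (u \<notin> X \<and> v \<in> X) + entering A t h X" for X
    unfolding entering_def sum.insert[OF \<open>finite A\<close> \<open>e \<notin> A\<close>]
    using \<open>e \<notin> A\<close> by (intro arg_cong2[of _ _ _ _ "(+)"] sum.cong) auto
  \<comment> \<open>If only \<open>v\<close> is in \<open>X\<close>, the new arc enters
    \<open>X\<close>; if both ends are in \<open>X\<close>, an induced edge is lost. Either way the
    demand drops by one.\<close>
  have dem1: "demand k E en (insert e A) (t(e := u)) (h(e := v)) X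
      = demand k (insert e E) en A t h X - of_bool (v \<in> X)" for X
    unfolding demand_def ent induced_def sum.insert[OF \<open>finite E\<close> \<open>e \<notin> E\<close>] en by simp
  then have dem: "sum (demand k E en (insert e A) (t(e := u)) (h(e := v))) P
      = sum (demand k (insert e E) en A t h) P - of_bool (v \<in> \<Union>P)"
    if "subpartition V P" for P
  proof -
    have "finite P" "disjoint P" using that \<open>finite V\<close> unfolding subpartition_def
      by (meson finite_UnionD finite_subset)+
    then show ?thesis
      unfolding dem1 sum_subtractf by (simp only: sum_of_bool_mem)
  qed
  have tch: "touching (insert e E) en S = touching E en S + of_bool (u \<in> S \<or> v \<in> S)" for S
    unfolding touching_def sum.insert[OF \<open>finite E\<close> \<open>e \<notin> E\<close>] en by simp
  from fail obtain P where P: "subpartition V P" and less: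
    "lower_capacity V k f E en (\<Union>P)
        < sum (demand k (insert e E) en A t h) P - of_bool (v \<in> \<Union>P) \<or>
      upper_capacity g E en (\<Union>P)
        < sum (demand k (insert e E) en A t h) P - of_bool (v \<in> \<Union>P)"
    unfolding packing_condition_def using dem by fastforce
  have le: "sum (demand k (insert e E) en A t h) P
        \<le> lower_capacity V k f (insert e E) en (\<Union>P)"
      "sum (demand k (insert e E) en A t h) P
        \<le> upper_capacity g (insert e E) en (\<Union>P)"
    using old P unfolding packing_condition_def by auto
  have uv: "u \<in> \<Union>P \<and> v \<notin> \<Union>P"
  proof (rule ccontr)
    assume "\<not> ?thesis"
    then have "touching (insert e E) en (\<Union>P) = touching E en (\<Union>P) + of_bool (v \<in> \<Union>P)"
      using tch by auto
    with less le show False unfolding lower_capacity_def upper_capacity_def by linarith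
  qed
  then have "touching (insert e E) en (\<Union>P) = touching E en (\<Union>P) + 1" "of_bool (v \<in> \<Union>P) = (0::int)"
    using tch by auto
  with less have "lower_capacity V k f (insert e E) en (\<Union>P)
        \<le> sum (demand k (insert e E) en A t h) P \<or>
      upper_capacity g (insert e E) en (\<Union>P)
        \<le> sum (demand k (insert e E) en A t h) P"
    unfolding lower_capacity_def upper_capacity_def by linarith
  with P uv show ?thesis by blast
qed

section \<open>Orienting edges and fixing the roots\<close>

text \<open>The vertex sums are modular, so strictness comes from \<open>touching\<close>. In the
  mixed case, passing to union and intersection adds \<open>sum f (T - S)\<close> and subtracts
  \<open>sum g (T - S)\<close>, which does not increase the total because \<open>f \<le> g\<close>
  on \<open>V\<close>.\<close>

lemma capacity_Un_Int:
  assumes V: "finite V" "S \<subseteq> V" "T \<subseteq> V" and fg: "\<forall>v\<in>V. f v \<le> g v"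
    and touching: "touching E en (S \<union> T) + touching E en (S \<inter> T) < touching E en S + touching E en T"
  shows "lower_capacity V k f E en (S \<union> T) + lower_capacity V k f E en (S \<inter> T)
      < lower_capacity V k f E en S + lower_capacity V k f E en T"
    and "upper_capacity g E en (S \<union> T) + upper_capacity g E en (S \<inter> T)
      < upper_capacity g E en S + upper_capacity g E en T"
    and "lower_capacity V k f E en (S \<union> T) + upper_capacity g E en (S \<inter> T)
      < lower_capacity V k f E en S + upper_capacity g E en T"
proof -
  have "sum f (T - S) \<le> sum g (T - S)" by (rule sum_mono) (use V fg in auto)
  with touching sum_Diff_Un_Int(1,3)[OF V, of f] sum_Diff_Un_Int(2,4)[OF V, of g]
  show "lower_capacity V k f E en (S \<union> T) + lower_capacity V k f E en (S \<inter> T)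
      < lower_capacity V k f E en S + lower_capacity V k f E en T"
    "upper_capacity g E en (S \<union> T) + upper_capacity g E en (S \<inter> T)
      < upper_capacity g E en S + upper_capacity g E en T"
    "lower_capacity V k f E en (S \<union> T) + upper_capacity g E en (S \<inter> T)
      < lower_capacity V k f E en S + upper_capacity g E en T"
    unfolding lower_capacity_def upper_capacity_def by linarith+
qed

text \<open>Here strictness comes from \<open>v\<close>, where \<open>f\<close> is smaller than
  \<open>g\<close>, instead of from an edge between \<open>S - T\<close> and
  \<open>T - S\<close>.\<close>

lemma lower_upper_capacity_Un_Int_strict:
  assumes V: "finite V" "S \<subseteq> V" "T \<subseteq> V" and fg: "\<forall>v\<in>V. f v \<le> g v"
    and v: "v \<in> T - S" "f v < g v"
  shows "lower_capacity V k f E en (S \<union> T) + upper_capacity g E en (S \<inter> T)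
      < lower_capacity V k f E en S + upper_capacity g E en T"
proof -
  have "sum f (T - S) < sum g (T - S)"
  proof (rule sum_strict_mono_ex1)
    show "finite (T - S)" using V finite_subset by blast
  qed (use V fg v in auto)
  with touching_submodular[of E en S T] sum_Diff_Un_Int(3)[OF V, of f] sum_Diff_Un_Int(4)[OF V, of g]
  show ?thesis unfolding lower_capacity_def upper_capacity_def by linarith
qed

text \<open>Failure of both orientations gives tight families \<open>P\<close> and \<open>Q\<close>,
  of which \<open>P\<close> covers only \<open>u\<close> and \<open>Q\<close> only \<open>v\<close>.
  Then \<open>e\<close> joins \<open>\<Union>P - \<Union>Q\<close> to
  \<open>\<Union>Q - \<Union>P\<close> and makes the capacity inequality strict.\<close>

lemma packing_condition_orient_either:
  assumes V: "finite V" and "finite E" "finite A" "e \<notin> E" "e \<notin> A"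
    and en: "en e = {u, v}" "u \<noteq> v" and fg: "\<forall>v\<in>V. f v \<le> g v"
    and old: "packing_condition V k f g (insert e E) en A t h"
  shows "packing_condition V k f g E en (insert e A) (t(e := u)) (h(e := v)) \<or>
    packing_condition V k f g E en (insert e A) (t(e := v)) (h(e := u))"
proof (rule ccontr)
  assume fail: "\<not> ?thesis"
  let ?E = "insert e E"
  let ?b = "demand k ?E en A t h" and ?c = "lower_capacity V k f ?E en" and ?d = "upper_capacity g ?E en"
  obtain P where P: "subpartition V P" "u \<in> \<Union>P" "v \<notin> \<Union>P" "?c (\<Union>P) \<le> sum ?b P \<or> ?d (\<Union>P) \<le> sum ?b P"
    using packing_condition_orient[OF assms(1-7) old] fail by auto
  have en': "en e = {v, u}" "v \<noteq> u" using en by auto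
  obtain Q where Q: "subpartition V Q" "v \<in> \<Union>Q" "u \<notin> \<Union>Q" "?c (\<Union>Q) \<le> sum ?b Q \<or> ?d (\<Union>Q) \<le> sum ?b Q"
    using packing_condition_orient[OF assms(1-5) en' old] fail by auto
  have sub: "\<Union>P \<subseteq> V" "\<Union>Q \<subseteq> V" using P(1) Q(1) unfolding subpartition_def by auto
  have touching: "touching ?E en (\<Union>P \<union> \<Union>Q) + touching ?E en (\<Union>P \<inter> \<Union>Q)
      < touching ?E en (\<Union>P) + touching ?E en (\<Union>Q)"
    using touching_submodular_strict[of ?E e en u v "\<Union>P" "\<Union>Q"] assms P Q by auto
  then have touching': "touching ?E en (\<Union>Q \<union> \<Union>P) + touching ?E en (\<Union>Q \<inter> \<Union>P)
      < touching ?E en (\<Union>Q) + touching ?E en (\<Union>P)"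
    by (simp add: Un_commute Int_commute)
  have bound: "\<forall>R. subpartition V R \<longrightarrow> sum ?b R \<le> ?c (\<Union>R)"
      "\<forall>R. subpartition V R \<longrightarrow> sum ?b R \<le> ?d (\<Union>R)"
    using old unfolding packing_condition_def by auto
  note cap = capacity_Un_Int[where f = f and g = g, OF V sub fg touching]
    capacity_Un_Int(3)[where f = f and g = g, OF V sub(2,1) fg touching']
  \<comment> \<open>In the mixed cases the lower capacity goes with the union and the upper one with
    the intersection, and the family tight for the lower capacity comes first; so in the last case
    \<open>P\<close> and \<open>Q\<close> change places.\<close>
  from P(4) Q(4) consider "?c (\<Union>P) \<le> sum ?b P" "?c (\<Union>Q) \<le> sum ?b Q"
    | "?d (\<Union>P) \<le> sum ?b P" "?d (\<Union>Q) \<le> sum ?b Q"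
    | "?c (\<Union>P) \<le> sum ?b P" "?d (\<Union>Q) \<le> sum ?b Q"
    | "?c (\<Union>Q) \<le> sum ?b Q" "?d (\<Union>P) \<le> sum ?b P" by blast
  then show False
  proof cases
    case 1
    show False by (rule tight_subpartitions_contradiction[where ca = "?c" and cb = "?c" and cc = "?c" and cd = "?c",
        OF V demand_intersecting_supermodular P(1) 1(1) Q(1) 1(2) bound(1) bound(1) cap(1)])
  next
    case 2
    show False by (rule tight_subpartitions_contradiction[where ca = "?d" and cb = "?d" and cc = "?d" and cd = "?d",
        OF V demand_intersecting_supermodular P(1) 2(1) Q(1) 2(2) bound(2) bound(2) cap(2)])
  next
    case 3
    show False by (rule tight_subpartitions_contradiction[where ca = "?c" and cb = "?d" and cc = "?c" and cd = "?d",
        OF V demand_intersecting_supermodular P(1) 3(1) Q(1) 3(2) bound(1) bound(2) cap(3)])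
  next
    case 4
    show False by (rule tight_subpartitions_contradiction[where ca = "?c" and cb = "?d" and cc = "?c" and cd = "?d",
        OF V demand_intersecting_supermodular Q(1) 4(1) P(1) 4(2) bound(1) bound(2) cap(4)])
  qed
qed

text \<open>Edges and arcs share one identifier type, so orienting an edge moves its identifier from
  \<open>E\<close> to \<open>A\<close> and updates the tail and head maps there.\<close>

lemma exists_orientation:
  assumes "finite E" "finite V" "finite A" "E \<inter> A = {}" "\<And>e. e \<in> E \<Longrightarrow> card (en e) = 2"
    and fg: "\<forall>v\<in>V. f v \<le> g v"
    and "packing_condition V k f g E en A t h"
  shows "\<exists>t' h'. (\<forall>x\<in>E. {t' x, h' x} = en x) \<and> (\<forall>x\<in>A. t' x = t x \<and> h' x = h x) \<and>
    packing_condition V k f g {} en (E \<union> A) t' h'"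
  using assms
proof (induction E arbitrary: A t h rule: finite_induct)
  case empty
  then show ?case by auto
next
  case (insert e E)
  have "e \<notin> A" using insert.prems by auto
  from insert.prems(4)[of e] obtain u v where "en e = {u, v}" "u \<noteq> v" by (auto simp: card_2_iff)
  \<comment> \<open>The ends are named anew so that \<open>v\<close> is the head, whichever
    orientation succeeded.\<close>
  then obtain u v where uv: "en e = {u, v}"
    and new: "packing_condition V k f g E en (insert e A) (t(e := u)) (h(e := v))"
    using packing_condition_orient_either[OF insert.prems(1) insert.hyps(1) insert.prems(2)
      insert.hyps(2) \<open>e \<notin> A\<close> _ _ fg insert.prems(6)] by (metis insert_commute)
  obtain t' h' where IH: "\<forall>x\<in>E. {t' x, h' x} = en x"
    "\<forall>x\<in>insert e A. t' x = (t(e := u)) x \<and> h' x = (h(e := v)) x"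
    "packing_condition V k f g {} en (E \<union> insert e A) t' h'"
    using insert.IH[OF insert.prems(1) _ _ _ fg new] insert.prems insert.hyps by auto
  have "\<forall>x\<in>insert e E. {t' x, h' x} = en x" using IH(1,2) uv by simp
  moreover have "\<forall>x\<in>A. t' x = t x \<and> h' x = h x" using IH(2) \<open>e \<notin> A\<close> by (metis fun_upd_other insertCI)
  ultimately show ?case using IH(3) by (intro exI[of _ t'] exI[of _ h']) simp
qed

text \<open>Raising \<open>f v\<close> costs one unit of lower capacity on sets without
  \<open>v\<close>; lowering \<open>g v\<close> costs one unit of upper capacity on sets with
  \<open>v\<close>. If both fail, a lower-tight family missing \<open>v\<close> and an upper-tight
  family covering \<open>v\<close> contradict each other.\<close>

lemma packing_condition_squeeze:
  assumes V: "finite V" and v: "v \<in> V" "f v < g v" and fg: "\<forall>v\<in>V. f v \<le> g v"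
    and old: "packing_condition V k f g E en A t h"
  shows "packing_condition V k (f(v := Suc (f v))) g E en A t h \<or>
    packing_condition V k f (g(v := g v - 1)) E en A t h"
proof (rule ccontr)
  assume fail: "\<not> ?thesis"
  let ?b = "demand k E en A t h" and ?c = "lower_capacity V k f E en" and ?d = "upper_capacity g E en"
  have c: "lower_capacity V k (f(v := Suc (f v))) E en S = ?c S - of_bool (v \<notin> S)" for S
  proof (cases "v \<in> S")
    case False
    then have "sum (f(v := Suc (f v))) (V - S) = Suc (sum f (V - S))"
      using V v by (simp add: sum.remove[of _ v])
    moreover have "of_bool (v \<notin> S) = (1::int)" using False by simp
    ultimately show ?thesis unfolding lower_capacity_def by linarith
  next
    case True
    then have "sum (f(v := Suc (f v))) (V - S) = sum f (V - S)" by (intro sum.cong) auto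
    with True show ?thesis unfolding lower_capacity_def by simp
  qed
  have d: "upper_capacity (g(v := g v - 1)) E en S = ?d S - of_bool (v \<in> S)" if "S \<subseteq> V" for S
  proof (cases "v \<in> S")
    case True
    then have "Suc (sum (g(v := g v - 1)) S) = sum g S"
      using V v finite_subset[OF that] by (simp add: sum.remove[of _ v])
    moreover have "of_bool (v \<in> S) = (1::int)" using True by simp
    ultimately show ?thesis unfolding upper_capacity_def by linarith
  next
    case False
    then have "sum (g(v := g v - 1)) S = sum g S" by (intro sum.cong) auto
    with False show ?thesis by (simp add: upper_capacity_def)
  qed
  have bound: "\<forall>R. subpartition V R \<longrightarrow> sum ?b R \<le> ?c (\<Union>R)"
      "\<forall>R. subpartition V R \<longrightarrow> sum ?b R \<le> ?d (\<Union>R)"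
    using old unfolding packing_condition_def by auto
  obtain P where P: "subpartition V P" "?c (\<Union>P) - of_bool (v \<notin> \<Union>P) < sum ?b P"
    using fail bound(2) unfolding packing_condition_def c by (meson not_le)
  have vP: "v \<notin> \<Union>P" and cP: "?c (\<Union>P) \<le> sum ?b P"
    using P(2) bound(1) P(1) by (auto split: if_splits simp: of_bool_def)
  obtain Q where Q: "subpartition V Q" "upper_capacity (g(v := g v - 1)) E en (\<Union>Q) < sum ?b Q"
    using fail bound(1) unfolding packing_condition_def by (meson not_le)
  have sub: "\<Union>P \<subseteq> V" "\<Union>Q \<subseteq> V" using P(1) Q(1) unfolding subpartition_def by auto
  have vQ: "v \<in> \<Union>Q" and dQ: "?d (\<Union>Q) \<le> sum ?b Q"
    using Q(2) bound(2) Q(1) d[OF sub(2)] by (auto split: if_splits simp: of_bool_def)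
  have vPQ: "v \<in> \<Union>Q - \<Union>P" using vP vQ by blast
  show False
    by (rule tight_subpartitions_contradiction[where ca = "?c" and cb = "?d" and cc = "?c" and cd = "?d",
        OF V demand_intersecting_supermodular P(1) cP Q(1) dQ bound(1) bound(2)
          lower_upper_capacity_Un_Int_strict[OF V sub fg vPQ v(2)]])
qed

text \<open>Induction on the total gap between \<open>f\<close> and \<open>g\<close> over
  \<open>V\<close>, which each squeeze reduces by one.\<close>

lemma exists_root_multiplicities:
  assumes V: "finite V" and fg: "\<forall>v\<in>V. f v \<le> g v"
    and "packing_condition V k f g E en A t h"
  shows "\<exists>m. (\<forall>v\<in>V. f v \<le> m v \<and> m v \<le> g v) \<and> packing_condition V k m m E en A t h"
  using fg assms(3)
proof (induction "\<Sum>v\<in>V. g v - f v" arbitrary: f g rule: less_induct)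
  case less
  show ?case
  proof (cases "\<exists>v\<in>V. f v < g v")
    case False
    then have eq: "\<forall>v\<in>V. f v = g v" using less.prems(1) by (meson le_neq_implies_less)
    \<comment> \<open>\<open>f\<close> and \<open>g\<close> are known to agree on \<open>V\<close>
      only, which suffices because \<open>\<Union>P\<close> lies in \<open>V\<close>.\<close>
    have "upper_capacity f E en (\<Union>P) = upper_capacity g E en (\<Union>P)" if "subpartition V P" for P
    proof -
      have "sum f (\<Union>P) = sum g (\<Union>P)" using that eq unfolding subpartition_def
        by (intro sum.cong) auto
      then show ?thesis by (simp add: upper_capacity_def)
    qed
    then have "packing_condition V k f f E en A t h"
      using less.prems(2) unfolding packing_condition_def by auto
    then show ?thesis using less.prems(1) by auto
  next
    case True
    then obtain v where v: "v \<in> V" "f v < g v" by auto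
    from packing_condition_squeeze[OF V v less.prems] show ?thesis
    proof
      assume new: "packing_condition V k (f(v := Suc (f v))) g E en A t h"
      have "(\<Sum>u\<in>V. g u - (f(v := Suc (f v))) u) < (\<Sum>u\<in>V. g u - f u)"
        using V v by (intro sum_strict_mono_ex1) auto
      from less.hyps[OF this _ new] obtain m where m:
        "\<forall>u\<in>V. (f(v := Suc (f v))) u \<le> m u \<and> m u \<le> g u" "packing_condition V k m m E en A t h"
        using less.prems(1) v by fastforce
      have "f u \<le> m u" if "u \<in> V" for u using m(1) that by (cases "u = v") (auto simp: Suc_le_eq)
      with m show ?thesis by (intro exI[of _ m]) simp
    next
      assume new: "packing_condition V k f (g(v := g v - 1)) E en A t h"
      have "(\<Sum>u\<in>V. (g(v := g v - 1)) u - f u) < (\<Sum>u\<in>V. g u - f u)"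
        using V v by (intro sum_strict_mono_ex1) auto
      from less.hyps[OF this _ new] obtain m where m:
        "\<forall>u\<in>V. f u \<le> m u \<and> m u \<le> (g(v := g v - 1)) u" "packing_condition V k m m E en A t h"
        using less.prems(1) v by fastforce
      have "m u \<le> g u" if "u \<in> V" for u using m(1) that by (cases "u = v") fastforce+
      with m show ?thesis by (intro exI[of _ m]) simp
    qed
  qed
qed

section \<open>Edmonds' theorem\<close>

text \<open>Records how an arborescence rooted at \<open>r\<close> is grown: \<open>R\<close> holds
  the vertices reached and \<open>B\<close> the arcs used. Each new arc leaves \<open>R\<close>, so
  the tree properties follow by induction.\<close>

inductive grown :: "('x \<Rightarrow> 'v) \<Rightarrow> ('x \<Rightarrow> 'v) \<Rightarrow> 'v \<Rightarrow> 'v set \<Rightarrow> 'x set \<Rightarrow> bool"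
  for t h r where
  root: "grown t h r {r} {}"
| attach: "grown t h r R B \<Longrightarrow> t a \<in> R \<Longrightarrow> h a \<notin> R \<Longrightarrow> grown t h r (insert (h a) R) (insert a B)"

definition missed :: "nat \<Rightarrow> (nat \<Rightarrow> 'v set) \<Rightarrow> 'v set \<Rightarrow> int" where
  "missed k R X = (\<Sum>i\<in>{1..k}. of_bool (R i \<inter> X = {}))"

lemma missed_supermodular:
  assumes "X \<inter> Y \<noteq> {}"
  shows "missed k R X + missed k R Y \<le> missed k R (X \<inter> Y) + missed k R (X \<union> Y)"
  unfolding missed_def sum.distrib[symmetric] by (rule sum_mono) auto

text \<open>The index \<open>i\<close> counts for the intersection, but neither for \<open>X\<close>
  nor for \<open>Y\<close>.\<close>

lemma missed_supermodular_strict: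
  assumes "i \<in> {1..k}" "R i \<inter> X \<noteq> {}" "R i \<inter> Y \<noteq> {}" "R i \<inter> X \<inter> Y = {}"
  shows "missed k R X + missed k R Y < missed k R (X \<inter> Y) + missed k R (X \<union> Y)"
  unfolding missed_def sum.distrib[symmetric]
proof (rule sum_strict_mono_ex1)
  show "\<exists>i\<in>{1..k}. (of_bool (R i \<inter> X = {}) + of_bool (R i \<inter> Y = {}) :: int)
      < of_bool (R i \<inter> (X \<inter> Y) = {}) + of_bool (R i \<inter> (X \<union> Y) = {})"
    using assms by (intro bexI[of _ i]) auto
qed auto

text \<open>Adding an arc to \<open>R i\<close> is safe if every set that it enters and that already
  meets \<open>R i\<close> has slack. A tight set with vertices inside and outside
  \<open>R i\<close> is called dangerous; a minimal such set contains an arc leaving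
  \<open>R i\<close>, and this arc is safe.\<close>

lemma exists_safe_arc:
  assumes V: "finite V" and A: "finite A" "\<And>a. a \<in> A \<Longrightarrow> t a \<in> V \<and> h a \<in> V"
    and cover: "\<And>X. X \<subseteq> V \<Longrightarrow> X \<noteq> {} \<Longrightarrow> missed k R X \<le> entering A t h X"
    and R: "\<And>i. i \<in> {1..k} \<Longrightarrow> R i \<noteq> {} \<and> R i \<subseteq> V"
    and i: "i \<in> {1..k}" "R i \<noteq> V"
  shows "\<exists>a\<in>A. t a \<in> R i \<and> h a \<notin> R i \<and>
    (\<forall>X. X \<subseteq> V \<longrightarrow> t a \<notin> X \<longrightarrow> h a \<in> X \<longrightarrow> R i \<inter> X \<noteq> {} \<longrightarrow> missed k R X < entering A t h X)"
proof -
  define dangerous where "dangerous X \<longleftrightarrow>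
    X \<subseteq> V \<and> X \<inter> R i \<noteq> {} \<and> X - R i \<noteq> {} \<and> entering A t h X = missed k R X" for X
  \<comment> \<open>\<open>V\<close> itself is dangerous: no arc enters it and no tree misses
    it.\<close>
  have "entering A t h V = 0" using A unfolding entering_def by (intro sum.neutral) auto
  moreover have "missed k R V = 0" using R unfolding missed_def by (intro sum.neutral) (auto simp: Int_absorb2)
  ultimately have "dangerous V" using R[OF i(1)] i(2) unfolding dangerous_def by auto
  moreover have "finite {X. dangerous X}"
    using V unfolding dangerous_def by (auto intro: finite_subset[of _ "Pow V"])
  ultimately obtain W where W: "dangerous W" and min: "\<And>X. dangerous X \<Longrightarrow> X \<subseteq> W \<Longrightarrow> X = W"
    using finite_has_minimal[of "{X. dangerous X}"] by auto
  \<comment> \<open>\<open>R i\<close> meets \<open>W\<close> but misses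
    \<open>W - R i\<close>.\<close>
  have "missed k R W < missed k R (W - R i)"
    unfolding missed_def
  proof (rule sum_strict_mono_ex1)
    show "\<exists>j\<in>{1..k}. (of_bool (R j \<inter> W = {}) :: int) < of_bool (R j \<inter> (W - R i) = {})"
      using W i unfolding dangerous_def by (intro bexI[of _ i]) auto
  qed auto
  also have "\<dots> \<le> entering A t h (W - R i)" using W unfolding dangerous_def by (intro cover) auto
  finally have "entering A t h W < entering A t h (W - R i)" using W unfolding dangerous_def by simp
  then obtain a where a: "a \<in> A" "(of_bool (t a \<notin> W \<and> h a \<in> W) :: int) < of_bool (t a \<notin> W - R i \<and> h a \<in> W - R i)"
    unfolding entering_def by (meson not_le sum_mono)
  \<comment> \<open>An arc entering \<open>W - R i\<close> but not \<open>W\<close> has its tail in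
    \<open>W\<close>, hence in \<open>R i\<close>.\<close>
  then have a': "t a \<in> W" "t a \<in> R i" "h a \<in> W" "h a \<notin> R i" by (auto split: if_splits simp: of_bool_def)
  have "missed k R X < entering A t h X"
    if X: "X \<subseteq> V" "t a \<notin> X" "h a \<in> X" "R i \<inter> X \<noteq> {}" for X
  proof (rule ccontr)
    assume "\<not> ?thesis"
    then have tight: "entering A t h X \<le> missed k R X" by simp
    have ne: "X \<inter> W \<noteq> {}" "X \<inter> W \<subseteq> V" "X \<union> W \<noteq> {}" "X \<union> W \<subseteq> V"
      using X a' W unfolding dangerous_def by auto
    have ent: "entering A t h (X \<inter> W) + entering A t h (X \<union> W) \<le> missed k R X + missed k R W"
      using entering_submodular[of A t h X W] tight W unfolding dangerous_def by linarith
    have c: "missed k R (X \<inter> W) \<le> entering A t h (X \<inter> W)" "missed k R (X \<union> W) \<le> entering A t h (X \<union> W)"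
      using cover ne by auto
    show False
    \<comment> \<open>If \<open>R i\<close> misses \<open>X \<inter> W\<close>, strict
      supermodularity is already a contradiction. Otherwise \<open>X \<inter> W\<close> is tight,
      contains \<open>h a\<close> outside \<open>R i\<close> and lacks \<open>t a\<close>: a
      dangerous set smaller than \<open>W\<close>.\<close>
    proof (cases "R i \<inter> X \<inter> W = {}")
      case True
      have "missed k R X + missed k R W < missed k R (X \<inter> W) + missed k R (X \<union> W)"
        using W X(4) True i(1) unfolding dangerous_def by (intro missed_supermodular_strict[of i]) auto
      with ent c show False by linarith
    next
      case False
      have "missed k R X + missed k R W \<le> missed k R (X \<inter> W) + missed k R (X \<union> W)"
        using ne by (intro missed_supermodular)
      with ent c have "entering A t h (X \<inter> W) = missed k R (X \<inter> W)" by linarith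
      then have "dangerous (X \<inter> W)" using False ne a' X unfolding dangerous_def by auto
      from min[OF this] a' X show False by auto
    qed
  qed
  with a(1) a' show ?thesis by auto
qed

text \<open>Induction on the number of vertices not yet reached, summed over \<open>i\<close>. The
  invariant \<open>cover\<close> speaks of the arcs not yet used by any \<open>B i\<close>.\<close>

lemma grown_packing:
  assumes V: "finite V" and A: "finite A" "\<And>a. a \<in> A \<Longrightarrow> t a \<in> V \<and> h a \<in> V"
    and B: "disjoint_family_on B {1..k}" "\<And>i. i \<in> {1..k} \<Longrightarrow> B i \<subseteq> A"
    and cover: "\<And>X. X \<subseteq> V \<Longrightarrow> X \<noteq> {} \<Longrightarrow> missed k R X \<le> entering (A - (\<Union>i\<in>{1..k}. B i)) t h X"
    and R: "\<And>i. i \<in> {1..k} \<Longrightarrow> grown t h (r i) (R i) (B i) \<and> R i \<noteq> {} \<and> R i \<subseteq> V"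
  shows "\<exists>B'. disjoint_family_on B' {1..k} \<and> (\<forall>i\<in>{1..k}. B' i \<subseteq> A \<and> grown t h (r i) V (B' i))"
  using B cover R
proof (induction "\<Sum>i\<in>{1..k}. card (V - R i)" arbitrary: R B rule: less_induct)
  case less
  show ?case
  proof (cases "\<forall>i\<in>{1..k}. R i = V")
    case True
    then have "\<forall>i\<in>{1..k}. B i \<subseteq> A \<and> grown t h (r i) V (B i)"
      using less.prems(2,4) by metis
    then show ?thesis using less.prems(1) by (intro exI[of _ B]) simp
  next
    case False
    then obtain i where i: "i \<in> {1..k}" "R i \<noteq> V" by blast
    define A' where "A' = A - (\<Union>i\<in>{1..k}. B i)"
    obtain a where a: "a \<in> A'" "t a \<in> R i" "h a \<notin> R i" and safe:
      "\<And>X. X \<subseteq> V \<Longrightarrow> t a \<notin> X \<Longrightarrow> h a \<in> X \<Longrightarrow> R i \<inter> X \<noteq> {} \<Longrightarrow> missed k R X < entering A' t h X"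
    proof -
      have "\<exists>a\<in>A'. t a \<in> R i \<and> h a \<notin> R i \<and>
          (\<forall>X. X \<subseteq> V \<longrightarrow> t a \<notin> X \<longrightarrow> h a \<in> X \<longrightarrow> R i \<inter> X \<noteq> {} \<longrightarrow> missed k R X < entering A' t h X)"
      proof (rule exists_safe_arc[where R = R and i = i, OF V _ _ _ _ i])
        show "finite A'" using A(1) unfolding A'_def by simp
        show "t a \<in> V \<and> h a \<in> V" if "a \<in> A'" for a using A(2) that unfolding A'_def by blast
        show "missed k R X \<le> entering A' t h X" if "X \<subseteq> V" "X \<noteq> {}" for X
          using less.prems(3)[OF that] unfolding A'_def .
        show "R j \<noteq> {} \<and> R j \<subseteq> V" if "j \<in> {1..k}" for j using less.prems(4)[OF that] by blast
      qed
      then show thesis using that by blast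
    qed
    have finA': "finite A'" using A unfolding A'_def by auto
    define R' where "R' = R(i := insert (h a) (R i))"
    define B' where "B' = B(i := insert a (B i))"
    have haV: "h a \<in> V" and aA: "a \<in> A" using a A unfolding A'_def by auto
    have aB: "a \<notin> B j" if "j \<in> {1..k}" for j using a that unfolding A'_def by auto
    have UB: "A - (\<Union>i\<in>{1..k}. B' i) = A' - {a}"
    proof -
      have "(\<Union>i\<in>{1..k}. B' i) = insert a (\<Union>i\<in>{1..k}. B i)"
        using i unfolding B'_def by (auto split: if_splits)
      then show ?thesis unfolding A'_def by auto
    qed
    have "(\<Sum>j\<in>{1..k}. card (V - R' j)) < (\<Sum>j\<in>{1..k}. card (V - R j))"
    proof (rule sum_strict_mono_ex1)
      show "\<forall>j\<in>{1..k}. card (V - R' j) \<le> card (V - R j)"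
        using V unfolding R'_def by (auto intro!: card_mono)
      have "card (V - R' i) < card (V - R i)"
        using V haV a unfolding R'_def by (intro psubset_card_mono) auto
      then show "\<exists>j\<in>{1..k}. card (V - R' j) < card (V - R j)" using i by auto
    qed auto
    then show ?thesis
    proof (rule less.hyps)
      show "disjoint_family_on B' {1..k}"
        using less.prems(1) aB unfolding B'_def disjoint_family_on_def by auto
      show "B' j \<subseteq> A" if "j \<in> {1..k}" for j
        using less.prems(2)[OF that] aA unfolding B'_def by auto
      show "grown t h (r j) (R' j) (B' j) \<and> R' j \<noteq> {} \<and> R' j \<subseteq> V" if "j \<in> {1..k}" for j
        using less.prems(4)[OF that] a haV unfolding R'_def B'_def by (auto intro: grown.attach)
      fix X assume X: "X \<subseteq> V" "X \<noteq> {}"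
      have ent: "entering A' t h X = entering (A' - {a}) t h X + of_bool (t a \<notin> X \<and> h a \<in> X)"
        unfolding entering_def sum.remove[OF finA' a(1)] by simp
      have cov: "missed k R X \<le> entering A' t h X" using less.prems(3)[OF X] unfolding A'_def .
      have mono: "missed k R' X \<le> missed k R X"
        unfolding missed_def R'_def by (rule sum_mono) auto
      have "missed k R' X \<le> entering (A' - {a}) t h X"
      proof (cases "t a \<notin> X \<and> h a \<in> X")
        case False
        with ent cov mono show ?thesis by auto
      next
        case True
        show ?thesis
        proof (cases "R i \<inter> X = {}")
          case False
          with safe[OF X(1)] True ent mono show ?thesis by auto
        next
          case iX: True
          have "missed k R' X < missed k R X"
            unfolding missed_def
          proof (rule sum_strict_mono_ex1)
            show "\<forall>j\<in>{1..k}. (of_bool (R' j \<inter> X = {}) :: int) \<le> of_bool (R j \<inter> X = {})"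
              unfolding R'_def by auto
            show "\<exists>j\<in>{1..k}. (of_bool (R' j \<inter> X = {}) :: int) < of_bool (R j \<inter> X = {})"
              using i iX True unfolding R'_def by (intro bexI[of _ i]) auto
          qed simp
          with ent cov True show ?thesis by auto
        qed
      qed
      then show "missed k R' X \<le> entering (A - (\<Union>i\<in>{1..k}. B' i)) t h X" unfolding UB .
    qed
  qed
qed

text \<open>The growth starts from single roots without arcs. Then \<open>missed\<close> is
  \<open>k\<close> minus the number of roots in \<open>X\<close>, and the invariant is Edmonds'
  condition.\<close>

lemma exists_arborescence_packing:
  assumes V: "finite V" and A: "finite A" "\<And>a. a \<in> A \<Longrightarrow> t a \<in> V \<and> h a \<in> V"
    and r: "\<And>i. i \<in> {1..k} \<Longrightarrow> r i \<in> V"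
    and cover: "\<And>X. X \<subseteq> V \<Longrightarrow> X \<noteq> {} \<Longrightarrow> int k \<le> entering A t h X + int (card {i\<in>{1..k}. r i \<in> X})"
  shows "\<exists>B. disjoint_family_on B {1..k} \<and> (\<forall>i\<in>{1..k}. B i \<subseteq> A \<and> grown t h (r i) V (B i))"
proof (rule grown_packing[OF V A, where R = "\<lambda>i. {r i}" and B = "\<lambda>_. {}"])
  fix X assume X: "X \<subseteq> V" "X \<noteq> {}"
  have "missed k (\<lambda>i. {r i}) X = (\<Sum>i\<in>{1..k}. 1 - of_bool (r i \<in> X))"
    unfolding missed_def by (intro sum.cong) auto
  also have "\<dots> = int k - int (card {i\<in>{1..k}. r i \<in> X})"
    unfolding sum_subtractf by (simp add: Int_def)
  finally have "missed k (\<lambda>i. {r i}) X \<le> entering A t h X" using cover[OF X] by linarith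
  then show "missed k (\<lambda>i. {r i}) X \<le> entering (A - (\<Union>i\<in>{1..k}. {})) t h X" by simp
qed (use r grown.root in \<open>auto simp: disjoint_family_on_def\<close>)

section \<open>Prescribed root multiplicities and the packing of arc sets\<close>

lemma exists_roots:
  assumes "finite V" "sum m V = k"
  shows "\<exists>r. (\<forall>i\<in>{1..k}. r i \<in> V) \<and> (\<forall>v\<in>V. card {i\<in>{1..k}. r i = v} = m v)"
proof -
  \<comment> \<open>Roots are read off a bijection from \<open>{1..k}\<close> to the pairs
    \<open>(v, j)\<close> with \<open>j < m v\<close>: each \<open>v\<close> occurs
    \<open>m v\<close> times as a first component.\<close>
  have "card (SIGMA v:V. {..<m v}) = card {1..k}" using assms by simp
  then obtain p where p: "bij_betw p {1..k} (SIGMA v:V. {..<m v})"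
    using assms finite_same_card_bij[of "{1..k}" "SIGMA v:V. {..<m v}"] by auto
  have "card {i\<in>{1..k}. fst (p i) = v} = m v" if "v \<in> V" for v
  proof -
    have "p ` {i\<in>{1..k}. fst (p i) = v} = {v} \<times> {..<m v}"
    proof
      show "p ` {i\<in>{1..k}. fst (p i) = v} \<subseteq> {v} \<times> {..<m v}"
      proof
        fix x assume "x \<in> p ` {i\<in>{1..k}. fst (p i) = v}"
        then have "x \<in> (SIGMA v:V. {..<m v})" "fst x = v" using bij_betwE[OF p] by blast+
        then show "x \<in> {v} \<times> {..<m v}" by auto
      qed
      show "{v} \<times> {..<m v} \<subseteq> p ` {i\<in>{1..k}. fst (p i) = v}"
      proof
        fix x assume x: "x \<in> {v} \<times> {..<m v}"
        then have "x \<in> p ` {1..k}" using that bij_betw_imp_surj_on[OF p] by auto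
        then obtain i where "i \<in> {1..k}" "x = p i" by blast
        moreover from this x have "fst (p i) = v" by auto
        ultimately show "x \<in> p ` {i\<in>{1..k}. fst (p i) = v}" by blast
      qed
    qed
    moreover have "inj_on p {i\<in>{1..k}. fst (p i) = v}"
      using bij_betw_imp_inj_on[OF p] by (rule inj_on_subset) auto
    ultimately show ?thesis using card_image[of p "{i\<in>{1..k}. fst (p i) = v}"] by (simp add: card_cartesian_product)
  qed
  moreover have "\<forall>i\<in>{1..k}. fst (p i) \<in> V"
    using bij_betwE[OF p] by (metis SigmaE fst_conv)
  ultimately show ?thesis by (intro exI[of _ "\<lambda>i. fst (p i)"]) auto
qed

lemma card_Collect_mem_eq_sum:
  assumes "finite X" "finite I"
  shows "card {i\<in>I. r i \<in> X} = (\<Sum>v\<in>X. card {i\<in>I. r i = v})"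
proof -
  have "{i\<in>I. r i \<in> X} = (\<Union>v\<in>X. {i\<in>I. r i = v})" by auto
  also have "card \<dots> = (\<Sum>v\<in>X. card {i\<in>I. r i = v})"
    using assms by (intro card_UN_disjoint) auto
  finally show ?thesis .
qed

lemma packing_from_condition:
  assumes V: "finite V" "V \<noteq> {}" and E: "finite E" "\<And>e. e \<in> E \<Longrightarrow> en e \<subseteq> V \<and> card (en e) = 2"
    and A: "finite A" "\<And>a. a \<in> A \<Longrightarrow> t a \<in> V \<and> h a \<in> V \<and> t a \<noteq> h a" and "E \<inter> A = {}"
    and fg: "\<forall>v\<in>V. f v \<le> g v"
    and cond: "packing_condition V k f g E en A t h"
  shows "\<exists>t' h' B r. (\<forall>x\<in>E. {t' x, h' x} = en x) \<and> (\<forall>x\<in>A. t' x = t x \<and> h' x = h x) \<and>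
    disjoint_family_on B {1..k} \<and>
    (\<forall>i\<in>{1..k}. r i \<in> V \<and> B i \<subseteq> E \<union> A \<and> grown t' h' (r i) V (B i)) \<and>
    (\<forall>v\<in>V. f v \<le> card {i\<in>{1..k}. r i = v} \<and> card {i\<in>{1..k}. r i = v} \<le> g v)"
proof -
  obtain t' h' where E': "\<forall>x\<in>E. {t' x, h' x} = en x" and A': "\<forall>x\<in>A. t' x = t x \<and> h' x = h x"
    and cond': "packing_condition V k f g {} en (E \<union> A) t' h'"
    using exists_orientation[OF E(1) V(1) A(1) assms(7) _ fg cond] E by blast
  obtain m where m: "\<forall>v\<in>V. f v \<le> m v \<and> m v \<le> g v" "packing_condition V k m m {} en (E \<union> A) t' h'"
    using exists_root_multiplicities[OF V(1) fg cond'] by auto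
  have EA: "t' x \<in> V \<and> h' x \<in> V" if "x \<in> E \<union> A" for x
    using that E' A' A(2) E(2) by (metis Un_iff insert_subset)
  \<comment> \<open>The empty subpartition gives \<open>sum m V \<le> k\<close>. Below,
    \<open>cover\<close> at \<open>V\<close>, which no arc enters, gives the converse, so there are
    exactly \<open>k\<close> roots.\<close>
  have "subpartition V {}" by (auto simp: subpartition_def disjoint_def)
  then have "sum (demand k {} en (E \<union> A) t' h') {} \<le> lower_capacity V k m {} en (\<Union>{})"
    using m(2) unfolding packing_condition_def by blast
  then have "sum m V \<le> k"
    by (simp add: lower_capacity_def touching_def del: of_nat_sum)
  \<comment> \<open>With no undirected edge left, the upper bound for a single member is the
    condition of Edmonds' theorem.\<close>
  have cover: "int k \<le> entering (E \<union> A) t' h' X + int (sum m X)" if "X \<subseteq> V" "X \<noteq> {}" for X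
  proof -
    have "subpartition V {X}" using that by (auto simp: subpartition_def)
    then have "sum (demand k {} en (E \<union> A) t' h') {X} \<le> upper_capacity m {} en (\<Union>{X})"
      using m(2) unfolding packing_condition_def by blast
    then show ?thesis
      by (simp add: upper_capacity_def touching_def demand_def induced_def del: of_nat_sum)
  qed
  have "entering (E \<union> A) t' h' V = 0" unfolding entering_def by (intro sum.neutral) (use EA in auto)
  with cover[of V] V \<open>sum m V \<le> k\<close> have mV: "sum m V = k" by (simp del: of_nat_sum)
  obtain r where r: "\<forall>i\<in>{1..k}. r i \<in> V" "\<forall>v\<in>V. card {i\<in>{1..k}. r i = v} = m v"
    using exists_roots[OF V(1) mV] by auto
  have "card {i\<in>{1..k}. r i \<in> X} = sum m X" if "X \<subseteq> V" for X
    unfolding card_Collect_mem_eq_sum[OF finite_subset[OF that V(1)] finite_atLeastAtMost]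
    using r(2) that by (intro sum.cong) auto
  then have cover': "int k \<le> entering (E \<union> A) t' h' X + int (card {i\<in>{1..k}. r i \<in> X})"
    if "X \<subseteq> V" "X \<noteq> {}" for X
    using cover that by metis
  obtain B where B: "disjoint_family_on B {1..k}"
    "\<forall>i\<in>{1..k}. B i \<subseteq> E \<union> A \<and> grown t' h' (r i) V (B i)"
    using exists_arborescence_packing[OF V(1) _ EA _ cover'] E(1) A(1) r(1) by blast
  show ?thesis
    by (rule exI[of _ t'], rule exI[of _ h'], rule exI[of _ B], rule exI[of _ r])
      (use E' A' B r m in simp)
qed

section \<open>Arborescences\<close>

lemma grown_basic:
  assumes "grown t h r R B"
  shows "r \<in> R" "h ` B = R - {r}" "inj_on h B"
    "\<And>x. x \<in> B \<Longrightarrow> t x \<in> R \<and> h x \<in> R \<and> t x \<noteq> h x"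
  using assms by (induction rule: grown.induct) (auto simp: inj_on_insert)

lemma grown_reachable:
  assumes "grown t h r R B" "v \<in> R"
  shows "(r, v) \<in> ((\<lambda>x. (t x, h x)) ` B)\<^sup>*"
  using assms
proof (induction arbitrary: v rule: grown.induct)
  case (attach R B a)
  let ?S = "((\<lambda>x. (t x, h x)) ` insert a B)\<^sup>*"
  have R: "(r, u) \<in> ?S" if "u \<in> R" for u
    using attach.IH[OF that] by (rule rtrancl_mono[THEN subsetD, rotated]) auto
  from R[OF attach.hyps(2)] have "(r, h a) \<in> ?S" by (rule rtrancl_into_rtrancl) auto
  with R attach.prems show ?case by auto
qed auto

text \<open>The head of the last arc is a leaf, since no earlier arc touches it, whereas a cycle
  through that arc would need a second edge there.\<close>

lemma grown_acyclic:
  assumes "grown t h r R B" "\<forall>x\<in>B. en x = {t x, h x}"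
  shows "\<not> undirected_cycle B en vs es"
  using assms
proof (induction rule: grown.induct)
  case root
  then show ?case by (auto simp: undirected_cycle_def)
next
  case (attach R B a)
  show ?case
  proof
    assume cyc: "undirected_cycle (insert a B) en vs es"
    let ?n = "length es"
    have es: "es \<noteq> []" "length vs = ?n" "distinct es" "set es \<subseteq> insert a B"
      and en: "\<And>i. i < ?n \<Longrightarrow> en (es ! i) = {vs ! i, vs ! (Suc i mod ?n)}"
      using cyc unfolding undirected_cycle_def by auto
    show False
    proof (cases "a \<in> set es")
      case False
      then have "undirected_cycle B en vs es" using cyc unfolding undirected_cycle_def by auto
      with attach show False by auto
    next
      case True
      then obtain i where i: "i < ?n" "es ! i = a" by (auto simp: in_set_conv_nth)
      have only_a: "es ! l = a" if "l < ?n" "h a \<in> en (es ! l)" for l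
      proof (rule ccontr)
        assume "es ! l \<noteq> a"
        then have "es ! l \<in> B" using es(4) that(1) nth_mem by blast
        then have "en (es ! l) \<subseteq> R" using attach.prems grown_basic(4)[OF attach.hyps(1)] by auto
        with that(2) attach.hyps(3) show False by auto
      qed
      have same: "l = i" if "l < ?n" "h a \<in> en (es ! l)" for l
        using only_a[OF that] i nth_eq_iff_index_eq[OF es(3) that(1) i(1)] by simp
      have enA: "en a = {t a, h a}" "t a \<noteq> h a" using attach by auto
      have "0 < ?n" using es by auto
      \<comment> \<open>A cycle of length one would be a loop.\<close>
      have "?n \<noteq> 1"
      proof
        assume "?n = 1"
        with en[OF i(1)] i enA show False by auto
      qed
      with \<open>0 < ?n\<close> have n: "1 < ?n" by linarith
      \<comment> \<open>The vertex \<open>h a\<close> is shared by position \<open>i\<close> and its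
        cyclic predecessor or successor. By \<open>same\<close> the two positions coincide, which is
        impossible for length above one.\<close>
      have "h a = vs ! i \<or> h a = vs ! (Suc i mod ?n)" using en[OF i(1)] i enA by auto
      then show False
      proof
        assume "h a = vs ! (Suc i mod ?n)"
        then have "Suc i mod ?n = i" using \<open>0 < ?n\<close> by (intro same) (auto simp: en)
        with i n show False by (cases "Suc i = ?n") auto
      next
        assume h: "h a = vs ! i"
        show False
        proof (cases i)
          case 0
          \<comment> \<open>Position 0 is preceded cyclically by the last position.\<close>
          have "Suc (?n - 1) mod ?n = 0" using n by (simp only: Suc_diff_1[OF \<open>0 < ?n\<close>] mod_self)
          then have "?n - 1 = i" using h 0 n en[of "?n - 1"] by (intro same) auto
          with 0 n show False by simp
        next
          case (Suc j)
          then have "j = i" using h i en[of j] by (intro same) auto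
          with Suc show False by simp
        qed
      qed
    qed
  qed
qed

lemma grown_undirected_tree:
  assumes B: "grown t h r R B" and en: "\<forall>x\<in>B. en x = {t x, h x}"
  shows "undirected_tree R B en"
proof -
  let ?S = "{(x, y). \<exists>e\<in>B. en e = {x, y}}"
  have "sym ?S" by (auto simp: sym_def insert_commute)
  then have "sym (?S\<^sup>*)" by (rule sym_rtrancl)
  have "(\<lambda>x. (t x, h x)) ` B \<subseteq> ?S" using en by auto
  then have "(r, v) \<in> ?S\<^sup>*" if "v \<in> R" for v
    using grown_reachable[OF B that] rtrancl_mono by blast
  then have "(u, v) \<in> ?S\<^sup>*" if "u \<in> R" "v \<in> R" for u v
    using that \<open>sym (?S\<^sup>*)\<close> by (meson rtrancl_trans symD)
  then show ?thesis
    using grown_basic(1)[OF B] grown_acyclic[OF B en]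
    unfolding undirected_tree_def undirected_connected_def by auto
qed

text \<open>The walks are compared from their last arcs: a vertex has at most one entering arc, and
  \<open>r\<close> has none.\<close>

lemma (in wf_digraph) awalk_unique_if_inj_head:
  assumes "inj_on (head G) (arcs G)" "r \<notin> head G ` arcs G" "awalk r p v" "awalk r q v"
  shows "p = q"
  using assms(3,4)
proof (induction p arbitrary: q v rule: rev_induct)
  case Nil
  then have "v = r" by (simp add: awalk_Nil_iff)
  with Nil(2) assms(2) show ?case by (cases q rule: rev_cases) (auto simp: awalk_simps)
next
  case (snoc x p)
  then have x: "x \<in> arcs G" "head G x = v" "awalk r p (tail G x)" by (auto simp: awalk_simps)
  then obtain q' y where q: "q = q' @ [y]"
    using snoc.prems(2) assms(2) by (cases q rule: rev_cases) (auto simp: awalk_simps)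
  then have y: "y \<in> arcs G" "head G y = v" "awalk r q' (tail G y)"
    using snoc.prems(2) by (auto simp: awalk_simps)
  have "x = y" using x y assms(1) by (auto dest: inj_onD)
  with snoc.IH[OF x(3)] y(3) q show ?case by simp
qed

lemma grown_arborescence:
  assumes B: "grown t h r R B"
  shows "arborescence \<lparr>verts = R, arcs = B, tail = t, head = h\<rparr> r"
proof -
  let ?D = "\<lparr>verts = R, arcs = B, tail = t, head = h\<rparr>"
  interpret wf_digraph ?D
    by unfold_locales (use grown_basic(4)[OF B] in auto)
  have "\<exists>!p. apath r p v" if "v \<in> R" for v
  proof -
    have "\<exists>p. awalk r p v"
      using grown_reachable[OF B that]
    proof (induction rule: rtrancl_induct)
      case base
      show ?case using grown_basic(1)[OF B] by (auto simp: awalk_Nil_iff intro!: exI[of _ "[]"])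
    next
      case (step y z)
      then obtain p a where "awalk r p y" "a \<in> B" "y = t a" "z = h a" by auto
      then have "awalk r (p @ [a]) z" using grown_basic(4)[OF B] by (auto simp: awalk_simps)
      then show ?case by blast
    qed
    then obtain p where p: "apath r p v" using apath_awalk_to_apath by blast
    have "inj_on (head ?D) (arcs ?D)" "r \<notin> head ?D ` arcs ?D"
      using grown_basic(2,3)[OF B] by auto
    from awalk_unique_if_inj_head[OF this] p show ?thesis by (auto dest: awalkI_apath)
  qed
  then show ?thesis
    using grown_undirected_tree[OF B, of "\<lambda>x. {t x, h x}"] grown_basic(1)[OF B] wf_digraph
    unfolding arborescence_def by auto
qed

text \<open>A path from \<open>r\<close> to a vertex of \<open>X\<close> starts outside
  \<open>X\<close>, so one of its arcs enters \<open>X\<close>.\<close>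

lemma arborescence_entering_arc:
  assumes D: "arborescence D r" and X: "X \<subseteq> verts D" "X \<noteq> {}" "r \<notin> X"
  shows "\<exists>a\<in>arcs D. tail D a \<notin> X \<and> head D a \<in> X"
proof -
  interpret wf_digraph D using D unfolding arborescence_def by auto
  have entry: "\<exists>a\<in>arcs D. tail D a \<notin> X \<and> head D a \<in> X"
    if "awalk u p v" "u \<notin> X" "v \<in> X" for u p v
    using that by (induction p arbitrary: u) (auto simp: awalk_simps)
  obtain v where "v \<in> X" using X by auto
  moreover from this obtain p where "awalk r p v"
    using D X unfolding arborescence_def by (meson awalkI_apath subsetD)
  ultimately show ?thesis using entry X by blast
qed

section \<open>Mixed graphs\<close>

text \<open>An edge meeting \<open>\<Union>P\<close> either lies inside exactly one member or
  crosses the subpartition. This trades \<open>crossing_edges\<close> for a function of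
  \<open>\<Union>P\<close>.\<close>

lemma crossing_edges_plus_induced:
  assumes "mixed_graph F" and P: "subpartition (verts F) P"
  shows "crossing_edges F P + (\<Sum>X\<in>P. card {e \<in> edges F. ends F e \<subseteq> X})
    = card {e \<in> edges F. ends F e \<inter> \<Union>P \<noteq> {}}"
proof -
  interpret mixed_graph F by fact
  have P': "finite P" "\<Union>P \<subseteq> verts F" "disjoint P"
    using P finite_verts unfolding subpartition_def by (meson finite_UnionD finite_subset)+
  let ?C = "{e \<in> edges F. \<exists>u v. ends F e = {u, v} \<and>
     (\<exists>X\<in>P. u \<in> X \<and> ((\<exists>Y\<in>P. Y \<noteq> X \<and> v \<in> Y) \<or> v \<in> verts F - \<Union>P))}"
  let ?I = "\<lambda>X. {e \<in> edges F. ends F e \<subseteq> X}"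
  have ne: "ends F e \<noteq> {}" if "e \<in> edges F" for e using edge_ends[OF that] by auto
  have "card (\<Union>X\<in>P. ?I X) = (\<Sum>X\<in>P. card (?I X))"
  proof (rule card_UN_disjoint)
    show "\<forall>X\<in>P. \<forall>Y\<in>P. X \<noteq> Y \<longrightarrow> ?I X \<inter> ?I Y = {}"
    proof (intro ballI impI equals0I)
      fix X Y e assume "X \<in> P" "Y \<in> P" "X \<noteq> Y" and e: "e \<in> ?I X \<inter> ?I Y"
      then have "X \<inter> Y = {}" using P'(3) unfolding disjoint_def by blast
      with e ne show False by blast
    qed
  qed (use P' finite_edges in auto)
  moreover have "?C \<inter> (\<Union>X\<in>P. ?I X) = {}"
  proof (rule equals0I)
    fix e assume "e \<in> ?C \<inter> (\<Union>X\<in>P. ?I X)"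
    then obtain u v X Z where e: "ends F e = {u, v}" "X \<in> P" "u \<in> X"
      "(\<exists>Y\<in>P. Y \<noteq> X \<and> v \<in> Y) \<or> v \<in> verts F - \<Union>P" "Z \<in> P" "ends F e \<subseteq> Z" by blast
    then have "Z = X" using P'(3) unfolding disjoint_def by blast
    with e P'(3) show False unfolding disjoint_def by blast
  qed
  moreover have "?C \<union> (\<Union>X\<in>P. ?I X) = {e \<in> edges F. ends F e \<inter> \<Union>P \<noteq> {}}"
  proof
    show "?C \<union> (\<Union>X\<in>P. ?I X) \<subseteq> {e \<in> edges F. ends F e \<inter> \<Union>P \<noteq> {}}"
      using ne by blast
    show "{e \<in> edges F. ends F e \<inter> \<Union>P \<noteq> {}} \<subseteq> ?C \<union> (\<Union>X\<in>P. ?I X)"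
    proof
      fix e assume e: "e \<in> {e \<in> edges F. ends F e \<inter> \<Union>P \<noteq> {}}"
      then obtain u X where u: "u \<in> ends F e" "u \<in> X" "X \<in> P" by auto
      have "card (ends F e) = 2" "ends F e \<subseteq> verts F" using e edge_ends by auto
      then obtain a b where "ends F e = {a, b}" "a \<in> verts F" "b \<in> verts F"
        by (auto simp: card_2_iff)
      \<comment> \<open>\<open>v\<close> is the end of \<open>e\<close> other than
        \<open>u\<close>.\<close>
      then obtain v where v: "ends F e = {u, v}" "v \<in> verts F"
        using u(1) by (metis insert_commute insert_iff singletonD)
      show "e \<in> ?C \<union> (\<Union>X\<in>P. ?I X)"
      proof (cases "v \<in> X")
        case True
        then show ?thesis using e u v by auto
      next
        case False
        then have "(\<exists>Y\<in>P. Y \<noteq> X \<and> v \<in> Y) \<or> v \<in> verts F - \<Union>P" using v(2) by auto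
        then show ?thesis using e u v by blast
      qed
    qed
  qed
  moreover have "card (?C \<union> (\<Union>X\<in>P. ?I X)) = card ?C + card (\<Union>X\<in>P. ?I X)"
    using \<open>?C \<inter> _ = {}\<close> P'(1) finite_edges by (intro card_Un_disjoint) auto
  ultimately show ?thesis unfolding crossing_edges_def by simp
qed

text \<open>
  \<open>'e + 'a\<close> is the common type of identifiers for edges and arcs. On \<open>Inl e\<close> the next two
  functions return junk, which orienting \<open>e\<close> overwrites.
\<close>

definition sum_tail :: "('v, 'a, 'e) mixed_graph \<Rightarrow> 'e + 'a \<Rightarrow> 'v" where
  "sum_tail F x = tail F (projr x)"

definition sum_head :: "('v, 'a, 'e) mixed_graph \<Rightarrow> 'e + 'a \<Rightarrow> 'v" where
  "sum_head F x = head F (projr x)"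

text \<open>By \<open>crossing_edges_plus_induced\<close> the demand sum contains the term
  \<open>touching\<close> of \<open>\<Union>P\<close>, which also occurs in both capacities and
  cancels.\<close>

lemma packing_condition_iff:
  fixes F :: "('v, 'a, 'e) mixed_graph"
  assumes F: "mixed_graph F"
  shows "packing_condition (verts F) k f g
      (Inl ` edges F) (underlying_ends F) (Inr ` arcs F) (sum_tail F) (sum_head F) \<longleftrightarrow>
    (\<forall>P. subpartition (verts F) P \<longrightarrow>
      int (crossing_edges F P) + (\<Sum>X\<in>P. int (in_deg F X))
        \<ge> int k * (int (card P) - 1) + int (\<Sum>v\<in>verts F - \<Union>P. f v)) \<and>
    (\<forall>P. subpartition (verts F) P \<longrightarrow>
      int (crossing_edges F P) + (\<Sum>X\<in>P. int (in_deg F X))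
        \<ge> int k * int (card P) - int (\<Sum>v\<in>\<Union>P. g v))"
proof -
  interpret mixed_graph F by fact
  let ?E = "Inl ` edges F :: ('e + 'a) set" and ?A = "Inr ` arcs F :: ('e + 'a) set"
  have ent: "entering ?A (sum_tail F) (sum_head F) X = int (in_deg F X)" for X
    using finite_arcs unfolding entering_def in_deg_def sum.reindex[OF inj_Inr]
    by (simp add: sum_tail_def sum_head_def Int_def)
  have ind: "induced ?E (underlying_ends F) X = int (card {e \<in> edges F. ends F e \<subseteq> X})" for X
    using finite_edges unfolding induced_def sum.reindex[OF inj_Inl]
    by (simp add: underlying_ends_def Int_def)
  have tch: "touching ?E (underlying_ends F) X = int (card {e \<in> edges F. ends F e \<inter> X \<noteq> {}})" for X
    using finite_edges unfolding touching_def sum.reindex[OF inj_Inl]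
    by (simp add: underlying_ends_def Int_def)
  have "sum (demand k ?E (underlying_ends F) ?A (sum_tail F) (sum_head F)) P
        - touching ?E (underlying_ends F) (\<Union>P)
      = int k * int (card P) - (\<Sum>X\<in>P. int (in_deg F X)) - int (crossing_edges F P)"
    if P: "subpartition (verts F) P" for P
  proof -
    have "sum (demand k ?E (underlying_ends F) ?A (sum_tail F) (sum_head F)) P
      = int k * int (card P) - (\<Sum>X\<in>P. int (in_deg F X))
        + int (\<Sum>X\<in>P. card {e \<in> edges F. ends F e \<subseteq> X})"
      unfolding demand_def ent ind by (simp add: sum.distrib sum_subtractf)
    then show ?thesis
      unfolding tch crossing_edges_plus_induced[OF F P, symmetric] by simp
  qed
  then have dem: "sum (demand k ?E (underlying_ends F) ?A (sum_tail F) (sum_head F)) P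
      = touching ?E (underlying_ends F) (\<Union>P)
      + int k * int (card P) - (\<Sum>X\<in>P. int (in_deg F X)) - int (crossing_edges F P)"
    if "subpartition (verts F) P" for P
    using that by (simp add: algebra_simps)
  let ?b = "demand k ?E (underlying_ends F) ?A (sum_tail F) (sum_head F)"
  have "sum ?b P \<le> lower_capacity (verts F) k f ?E (underlying_ends F) (\<Union>P) \<longleftrightarrow>
      int (crossing_edges F P) + (\<Sum>X\<in>P. int (in_deg F X))
        \<ge> int k * (int (card P) - 1) + int (\<Sum>v\<in>verts F - \<Union>P. f v)"
    "sum ?b P \<le> upper_capacity g ?E (underlying_ends F) (\<Union>P) \<longleftrightarrow>
      int (crossing_edges F P) + (\<Sum>X\<in>P. int (in_deg F X))
        \<ge> int k * int (card P) - int (\<Sum>v\<in>\<Union>P. g v)"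
    if "subpartition (verts F) P" for P
    unfolding dem[OF that] lower_capacity_def upper_capacity_def right_diff_distrib mult_1_right
    by (rule iffI; linarith)+
  then show ?thesis unfolding packing_condition_def by blast
qed

text \<open>\<open>t\<close> and \<open>h\<close> orient every edge of \<open>F\<close>; restricted
  to the arc set \<open>B\<close> they form the orientation that a mixed arborescence asks for, and
  \<open>grown\<close> makes it an arborescence.\<close>

lemma grown_spanning_mixed_arborescence:
  assumes F: "mixed_graph F"
    and t: "\<forall>e\<in>edges F. {t (Inl e), h (Inl e)} = ends F e"
      "\<forall>a\<in>arcs F. t (Inr a) = tail F a \<and> h (Inr a) = head F a"
    and B: "B \<subseteq> edges F <+> arcs F" "grown t h r (verts F) B"
  shows "spanning_mixed_arborescence F r (F\<lparr>arcs := Inr -` B, edges := Inl -` B\<rparr>)"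
proof -
  interpret mixed_graph F by fact
  let ?T = "F\<lparr>arcs := Inr -` B, edges := Inl -` B\<rparr>"
  have sub: "Inl -` B \<subseteq> edges F" "Inr -` B \<subseteq> arcs F" using B(1) by auto
  have plus: "edges ?T <+> arcs ?T = B"
  proof
    show "B \<subseteq> edges ?T <+> arcs ?T"
    proof
      fix x assume "x \<in> B"
      then show "x \<in> edges ?T <+> arcs ?T" by (cases x) auto
    qed
  qed auto
  have "mixed_graph ?T"
  proof
    show "ends ?T e \<subseteq> verts ?T \<and> card (ends ?T e) = 2" if "e \<in> edges ?T" for e
      using edge_ends[of e] sub(1) that by auto
  qed (use sub finite_verts verts_nonempty arc_tail arc_head arc_no_loop
        finite_subset[OF sub(1) finite_edges] finite_subset[OF sub(2) finite_arcs] in auto)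
  then have "mixed_subgraph ?T F" using sub unfolding mixed_subgraph_def by simp
  moreover have "undirected_tree (verts ?T) (edges ?T <+> arcs ?T) (underlying_ends ?T)"
    unfolding plus
  proof (simp, rule grown_undirected_tree[OF B(2)])
    show "\<forall>x\<in>B. underlying_ends ?T x = {t x, h x}"
    proof
      fix x assume x: "x \<in> B"
      show "underlying_ends ?T x = {t x, h x}"
      proof (cases x)
        case (Inl e)
        then have "{t (Inl e), h (Inl e)} = ends F e" using x sub t(1) by blast
        with Inl show ?thesis by (simp add: underlying_ends_def)
      next
        case (Inr a)
        with x sub t(2) show ?thesis by (auto simp: underlying_ends_def)
      qed
    qed
  qed
  moreover have "is_orientation ?T \<lparr>verts = verts F, arcs = B, tail = t, head = h\<rparr>"
  proof -
    have "{t (Inl e), h (Inl e)} = ends F e" if "Inl e \<in> B" for e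
      using that sub t(1) by blast
    moreover have "t (Inr a) = tail F a \<and> h (Inr a) = head F a" if "Inr a \<in> B" for a
      using that sub t(2) by blast
    ultimately show ?thesis unfolding is_orientation_def plus by simp
  qed
  ultimately show ?thesis
    using grown_arborescence[OF B(2)]
    unfolding spanning_mixed_arborescence_def mixed_arborescence_def by auto
qed

text \<open>For each \<open>i\<close> and each member \<open>X\<close> without \<open>r i\<close>,
  the orientation of \<open>T i\<close> has an arc entering \<open>X\<close>. Choosing one for every
  such pair maps the pairs injectively to crossing edges and arcs entering members.\<close>

lemma sum_card_missed_parts_le:
  fixes F :: "('v, 'a, 'e) mixed_graph" and T :: "nat \<Rightarrow> ('v, 'a, 'e) mixed_graph"
  assumes F: "mixed_graph F" and "finite I"
    and T: "\<And>i. i \<in> I \<Longrightarrow> spanning_mixed_arborescence F (r i) (T i)"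
    and disj: "disjoint_family_on (\<lambda>i. edges (T i)) I" "disjoint_family_on (\<lambda>i. arcs (T i)) I"
    and P: "subpartition (verts F) P"
  shows "(\<Sum>X\<in>P. card {i\<in>I. r i \<notin> X}) \<le> crossing_edges F P + (\<Sum>X\<in>P. in_deg F X)"
proof -
  interpret mixed_graph F by fact
  have P': "finite P" "\<Union>P \<subseteq> verts F" "{} \<notin> P"
    and dj: "\<And>X Y x. X \<in> P \<Longrightarrow> Y \<in> P \<Longrightarrow> x \<in> X \<Longrightarrow> x \<in> Y \<Longrightarrow> X = Y"
    using P finite_verts unfolding subpartition_def disjoint_def
    by (meson finite_UnionD finite_subset) (use P in \<open>auto simp: subpartition_def disjoint_def\<close>)
  let ?C = "{e \<in> edges F. \<exists>u v. ends F e = {u, v} \<and>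
     (\<exists>X\<in>P. u \<in> X \<and> ((\<exists>Y\<in>P. Y \<noteq> X \<and> v \<in> Y) \<or> v \<in> verts F - \<Union>P))}"
  let ?A = "\<lambda>X. {a \<in> arcs F. tail F a \<notin> X \<and> head F a \<in> X}"
  let ?S = "SIGMA X:P. {i\<in>I. r i \<notin> X}"
  have "\<exists>D. is_orientation (T i) D \<and> arborescence D (r i)" if "i \<in> I" for i
    using T[OF that] unfolding spanning_mixed_arborescence_def mixed_arborescence_def by auto
  then obtain D where D: "\<And>i. i \<in> I \<Longrightarrow> is_orientation (T i) (D i) \<and> arborescence (D i) (r i)"
    by metis
  have T': "edges (T i) \<subseteq> edges F" "arcs (T i) \<subseteq> arcs F" "ends (T i) = ends F" "tail (T i) = tail F"
      "head (T i) = head F" "verts (T i) = verts F" if "i \<in> I" for i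
    using T[OF that]
    unfolding spanning_mixed_arborescence_def mixed_arborescence_def mixed_subgraph_def by auto
  have DT: "arcs (D i) = edges (T i) <+> arcs (T i)" "verts (D i) = verts F"
      "\<And>e. e \<in> edges (T i) \<Longrightarrow> {tail (D i) (Inl e), head (D i) (Inl e)} = ends F e"
      "\<And>a. a \<in> arcs (T i) \<Longrightarrow> tail (D i) (Inr a) = tail F a \<and> head (D i) (Inr a) = head F a"
    if "i \<in> I" for i
    using D[OF that] T'[OF that] unfolding is_orientation_def by auto
  have "\<exists>x\<in>arcs (D i). tail (D i) x \<notin> X \<and> head (D i) x \<in> X" if "X \<in> P" "i \<in> I" "r i \<notin> X" for X i
    using arborescence_entering_arc[of "D i" "r i" X] D[OF that(2)] DT(2)[OF that(2)] that P' by auto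
  then obtain x where x: "\<And>X i. X \<in> P \<Longrightarrow> i \<in> I \<Longrightarrow> r i \<notin> X \<Longrightarrow>
      x X i \<in> arcs (D i) \<and> tail (D i) (x X i) \<notin> X \<and> head (D i) (x X i) \<in> X"
    by metis
  have "inj_on (\<lambda>(X, i). x X i) ?S"
  proof (rule inj_onI, clarify)
    fix X i Y j assume X: "X \<in> P" "i \<in> I" "r i \<notin> X" and Y: "Y \<in> P" "j \<in> I" "r j \<notin> Y"
      and eq: "x X i = x Y j"
    have "i = j"
    proof (rule ccontr)
      assume "i \<noteq> j"
      then have "arcs (D i) \<inter> arcs (D j) = {}"
        using disj[THEN disjoint_family_onD, OF X(2) Y(2)] DT(1)[OF X(2)] DT(1)[OF Y(2)] by auto
      then show False using x[OF X] x[OF Y] eq by auto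
    qed
    \<comment> \<open>An undirected edge may join two members, but its head in \<open>D i\<close>
      lies in only one of them.\<close>
    then have "X = Y" using x[OF X] x[OF Y] eq dj[OF X(1) Y(1)] by auto
    with \<open>i = j\<close> show "X = Y \<and> i = j" by simp
  qed
  moreover have "(\<lambda>(X, i). x X i) ` ?S \<subseteq> ?C <+> (\<Union>X\<in>P. ?A X)"
  proof clarify
    fix X i assume X: "X \<in> P" "i \<in> I" "r i \<notin> X"
    show "x X i \<in> ?C <+> (\<Union>X\<in>P. ?A X)"
    proof (cases "x X i")
      case (Inl e)
      let ?u = "head (D i) (Inl e)" and ?v = "tail (D i) (Inl e)"
      have e: "e \<in> edges (T i)" "?v \<notin> X" "?u \<in> X" using x[OF X] Inl DT(1)[OF X(2)] by auto
      have ends: "ends F e = {?u, ?v}" using DT(3)[OF X(2) e(1)] by auto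
      have eF: "e \<in> edges F" using e T'(1)[OF X(2)] by auto
      have "?v \<in> verts F" using edge_ends[OF eF] ends by auto
      then have "(\<exists>Y\<in>P. Y \<noteq> X \<and> ?v \<in> Y) \<or> ?v \<in> verts F - \<Union>P" using e(2) by blast
      then have "e \<in> ?C" using eF ends X(1) e(3) by blast
      with Inl show ?thesis by auto
    next
      case (Inr a)
      then have "a \<in> arcs (T i)" using x[OF X] DT(1)[OF X(2)] by auto
      then have "a \<in> ?A X" using x[OF X] Inr DT(4)[OF X(2)] T'(2)[OF X(2)] by auto
      with X(1) Inr show ?thesis by auto
    qed
  qed
  moreover have fin: "finite ?C" "finite (\<Union>X\<in>P. ?A X)" using finite_edges finite_arcs P'(1) by auto
  ultimately have "card ?S \<le> card (?C <+> (\<Union>X\<in>P. ?A X))" by (intro card_inj_on_le) auto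
  also have "\<dots> = card ?C + card (\<Union>X\<in>P. ?A X)" using fin by (rule card_Plus)
  also have "card (\<Union>X\<in>P. ?A X) \<le> (\<Sum>X\<in>P. card (?A X))" using P'(1) by (rule card_UN_le)
  finally show ?thesis
    using P'(1) \<open>finite I\<close> by (simp add: crossing_edges_def in_deg_def)
qed

text \<open>Each root lies in at most one member, so the pairs \<open>(X, i)\<close> with
  \<open>r i\<close> outside \<open>X\<close> number \<open>k * card P\<close> minus the number of
  roots in \<open>\<Union>P\<close>. That number is at most \<open>sum g (\<Union>P)\<close>, and at
  most \<open>k - sum f (verts F - \<Union>P)\<close>.\<close>

lemma packing_necessary:
  fixes F :: "('v, 'a, 'e) mixed_graph" and T :: "nat \<Rightarrow> ('v, 'a, 'e) mixed_graph"
  assumes F: "mixed_graph F"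
    and T: "\<And>i. i \<in> {1..k} \<Longrightarrow> r i \<in> verts F \<and> spanning_mixed_arborescence F (r i) (T i)"
    and disj: "disjoint_family_on (\<lambda>i. edges (T i)) {1..k}" "disjoint_family_on (\<lambda>i. arcs (T i)) {1..k}"
    and roots: "\<And>v. v \<in> verts F \<Longrightarrow>
      f v \<le> card {i\<in>{1..k}. r i = v} \<and> card {i\<in>{1..k}. r i = v} \<le> g v"
    and P: "subpartition (verts F) P"
  shows "int k * (int (card P) - 1) + int (\<Sum>v\<in>verts F - \<Union>P. f v)
      \<le> int (crossing_edges F P) + (\<Sum>X\<in>P. int (in_deg F X))"
    and "int k * int (card P) - int (\<Sum>v\<in>\<Union>P. g v)
      \<le> int (crossing_edges F P) + (\<Sum>X\<in>P. int (in_deg F X))"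
proof -
  interpret mixed_graph F by fact
  have P': "finite P" "\<Union>P \<subseteq> verts F" "disjoint P"
    using P finite_verts unfolding subpartition_def by (meson finite_UnionD finite_subset)+
  have finU: "finite (\<Union>P)" using P'(2) finite_verts finite_subset by blast
  let ?in = "card {i\<in>{1..k}. r i \<in> \<Union>P}" and ?out = "card {i\<in>{1..k}. r i \<in> verts F - \<Union>P}"
  have "int (card {i\<in>{1..k}. r i \<notin> X}) = (\<Sum>i\<in>{1..k}. 1 - of_bool (r i \<in> X))" for X
  proof -
    have "(\<Sum>i\<in>{1..k}. 1 - of_bool (r i \<in> X) :: int) = (\<Sum>i\<in>{1..k}. of_bool (r i \<notin> X))"
      by (intro sum.cong) auto
    then show ?thesis by (simp add: Int_def)
  qed
  then have "(\<Sum>X\<in>P. int (card {i\<in>{1..k}. r i \<notin> X}))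
      = (\<Sum>X\<in>P. \<Sum>i\<in>{1..k}. 1 - of_bool (r i \<in> X))" by simp
  also have "\<dots> = (\<Sum>i\<in>{1..k}. \<Sum>X\<in>P. 1 - of_bool (r i \<in> X))" by (rule sum.swap)
  also have "\<dots> = (\<Sum>i\<in>{1..k}. int (card P) - of_bool (r i \<in> \<Union>P))"
    unfolding sum_subtractf sum_of_bool_mem[OF P'(3,1)] by simp
  also have "\<dots> = int k * int (card P) - int ?in"
    unfolding sum_subtractf by (simp add: Int_def)
  finally have "int (\<Sum>X\<in>P. card {i\<in>{1..k}. r i \<notin> X}) = int k * int (card P) - int ?in"
    unfolding of_nat_sum .
  moreover have "(\<Sum>X\<in>P. card {i\<in>{1..k}. r i \<notin> X}) \<le> crossing_edges F P + (\<Sum>X\<in>P. in_deg F X)"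
    by (rule sum_card_missed_parts_le[OF F finite_atLeastAtMost _ disj P]) (use T in blast)
  then have "int (\<Sum>X\<in>P. card {i\<in>{1..k}. r i \<notin> X})
      \<le> int (crossing_edges F P) + (\<Sum>X\<in>P. int (in_deg F X))"
    unfolding of_nat_sum[symmetric] of_nat_add[symmetric] of_nat_le_iff .
  ultimately have count: "int k * int (card P) - int ?in
      \<le> int (crossing_edges F P) + (\<Sum>X\<in>P. int (in_deg F X))" by simp
  have "?in = (\<Sum>v\<in>\<Union>P. card {i\<in>{1..k}. r i = v})"
    by (rule card_Collect_mem_eq_sum[OF finU finite_atLeastAtMost])
  also have "\<dots> \<le> (\<Sum>v\<in>\<Union>P. g v)" using roots P'(2) by (intro sum_mono) auto
  finally show "int k * int (card P) - int (\<Sum>v\<in>\<Union>P. g v)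
      \<le> int (crossing_edges F P) + (\<Sum>X\<in>P. int (in_deg F X))" using count by linarith
  have "(\<Sum>v\<in>verts F - \<Union>P. f v) \<le> (\<Sum>v\<in>verts F - \<Union>P. card {i\<in>{1..k}. r i = v})"
    using roots by (intro sum_mono) auto
  also have "\<dots> = ?out" using finite_verts by (intro card_Collect_mem_eq_sum[symmetric]) auto
  finally have out: "(\<Sum>v\<in>verts F - \<Union>P. f v) \<le> ?out" .
  have "{i\<in>{1..k}. r i \<in> \<Union>P} \<union> {i\<in>{1..k}. r i \<in> verts F - \<Union>P} = {1..k}" using T by auto
  moreover have "card ({i\<in>{1..k}. r i \<in> \<Union>P} \<union> {i\<in>{1..k}. r i \<in> verts F - \<Union>P}) = ?in + ?out"
    by (intro card_Un_disjoint) auto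
  ultimately have "?in + ?out = k" by simp
  then show "int k * (int (card P) - 1) + int (\<Sum>v\<in>verts F - \<Union>P. f v)
      \<le> int (crossing_edges F P) + (\<Sum>X\<in>P. int (in_deg F X))"
    using count out unfolding right_diff_distrib by linarith
qed

theorem theorem1p6:
  fixes F :: "('v, 'a, 'e) mixed_graph" and k :: nat and f g :: "'v \<Rightarrow> nat"
  assumes "mixed_graph F"
    and "k > 0"
    and "\<And>v. v \<in> verts F \<Longrightarrow> f v \<le> g v"
  shows "(\<exists>(T :: nat \<Rightarrow> ('v, 'a, 'e) mixed_graph) (r :: nat \<Rightarrow> 'v).
            (\<forall>i\<in>{1..k}. r i \<in> verts F \<and> spanning_mixed_arborescence F (r i) (T i)) \<and>
            disjoint_family_on (\<lambda>i. edges (T i)) {1..k} \<and>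
            disjoint_family_on (\<lambda>i. arcs (T i)) {1..k} \<and>
            (\<forall>v\<in>verts F. f v \<le> card {i\<in>{1..k}. r i = v} \<and> card {i\<in>{1..k}. r i = v} \<le> g v))
     \<longleftrightarrow>
         (\<Sum>v\<in>verts F. f v) \<le> k \<and>
         (\<forall>P. subpartition (verts F) P \<longrightarrow>
            int (crossing_edges F P) + (\<Sum>X\<in>P. int (in_deg F X))
              \<ge> int k * (int (card P) - 1) + int (\<Sum>v\<in>verts F - \<Union>P. f v)) \<and>
         (\<forall>P. subpartition (verts F) P \<longrightarrow>
            int (crossing_edges F P) + (\<Sum>X\<in>P. int (in_deg F X))
              \<ge> int k * int (card P) - int (\<Sum>v\<in>\<Union>P. g v))"
    (is "?packing \<longleftrightarrow> ?i \<and> ?ii \<and> ?iii")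
proof
  assume ?packing
  then obtain T r where T: "\<And>i. i \<in> {1..k} \<Longrightarrow> r i \<in> verts F \<and> spanning_mixed_arborescence F (r i) (T i)"
    and disj: "disjoint_family_on (\<lambda>i. edges (T i)) {1..k}" "disjoint_family_on (\<lambda>i. arcs (T i)) {1..k}"
    and roots: "\<And>v. v \<in> verts F \<Longrightarrow>
      f v \<le> card {i\<in>{1..k}. r i = v} \<and> card {i\<in>{1..k}. r i = v} \<le> g v"
    by blast
  \<comment> \<open>For \<open>P = {}\<close> the integer \<open>card P - 1\<close> is
    \<open>-1\<close> and nothing crosses or enters, so (ii) becomes (i).\<close>
  have "subpartition (verts F) {}" by (simp add: subpartition_def disjoint_def)
  from packing_necessary(1)[OF assms(1) T disj roots this]
  have ?i by (simp add: crossing_edges_def del: of_nat_sum)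
  with packing_necessary[OF assms(1) T disj roots] show "?i \<and> ?ii \<and> ?iii" by blast
next
  interpret mixed_graph F by fact
  assume "?i \<and> ?ii \<and> ?iii"
  then have cond: "packing_condition (verts F) k f g
      (Inl ` edges F) (underlying_ends F) (Inr ` arcs F) (sum_tail F) (sum_head F)"
    unfolding packing_condition_iff[OF assms(1)] by blast
  have "\<exists>t h B r. (\<forall>x\<in>Inl ` edges F. {t x, h x} = underlying_ends F x) \<and>
    (\<forall>x\<in>Inr ` arcs F. t x = sum_tail F x \<and> h x = sum_head F x) \<and>
    disjoint_family_on B {1..k} \<and>
    (\<forall>i\<in>{1..k}. r i \<in> verts F \<and> B i \<subseteq> Inl ` edges F \<union> Inr ` arcs F \<and> grown t h (r i) (verts F) (B i)) \<and>
    (\<forall>v\<in>verts F. f v \<le> card {i\<in>{1..k}. r i = v} \<and> card {i\<in>{1..k}. r i = v} \<le> g v)"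
  proof (rule packing_from_condition[OF finite_verts verts_nonempty _ _ _ _ _ _ cond])
    show "underlying_ends F x \<subseteq> verts F \<and> card (underlying_ends F x) = 2" if "x \<in> Inl ` edges F" for x
      using that edge_ends by (force simp: underlying_ends_def)
    show "sum_tail F x \<in> verts F \<and> sum_head F x \<in> verts F \<and> sum_tail F x \<noteq> sum_head F x"
      if "x \<in> Inr ` arcs F" for x
      using that arc_tail arc_head arc_no_loop by (auto simp: sum_tail_def sum_head_def)
  qed (use finite_edges finite_arcs assms(3) in auto)
  then obtain t h B r where t0: "\<forall>x\<in>Inl ` edges F. {t x, h x} = underlying_ends F x"
      "\<forall>x\<in>Inr ` arcs F. t x = sum_tail F x \<and> h x = sum_head F x"
    and B: "disjoint_family_on B {1..k}"
      "\<forall>i\<in>{1..k}. r i \<in> verts F \<and> B i \<subseteq> Inl ` edges F \<union> Inr ` arcs F \<and> grown t h (r i) (verts F) (B i)"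
    and r: "\<forall>v\<in>verts F. f v \<le> card {i\<in>{1..k}. r i = v} \<and> card {i\<in>{1..k}. r i = v} \<le> g v"
    by (elim exE conjE) (rule that)
  have t: "\<forall>e\<in>edges F. {t (Inl e), h (Inl e)} = ends F e"
      "\<forall>a\<in>arcs F. t (Inr a) = tail F a \<and> h (Inr a) = head F a"
    using t0 by (auto simp: underlying_ends_def sum_tail_def sum_head_def)
  let ?T = "\<lambda>i. F\<lparr>arcs := Inr -` B i, edges := Inl -` B i\<rparr>"
  show ?packing
  proof (intro exI conjI ballI)
    show "disjoint_family_on (\<lambda>i. edges (?T i)) {1..k}" "disjoint_family_on (\<lambda>i. arcs (?T i)) {1..k}"
      using B(1) unfolding disjoint_family_on_def by auto
    show "spanning_mixed_arborescence F (r i) (?T i)" if "i \<in> {1..k}" for i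
      using B(2) that by (intro grown_spanning_mixed_arborescence[OF assms(1) t]) (auto simp: Plus_def)
  qed (use r B(2) in auto)
qed

end
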